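(* Let $q$ be an odd prime power, $\lambda$ a divisor of $q+1$ with $2\le\lambda<q+1$, $m=2t+1\ge5$ with $t$ even, and $n=\frac{q^m+1}{\lambda}$. For an integer $\delta$ with $1\le\delta-1\le\frac{2q^{t+1}+2q-1}{\lambda}$ put $\epsilon=\lceil(\delta-1)(1-q^{-1})\rceil$. Then the LCD BCH code $\mathcal{C}_{(n,q,\delta,1)}$ has parameters $[n,k,d\ge\delta]$ and $\mathcal{C}_{(n,q,\delta+1,0)}$ has parameters $[n,k-1,d\ge2\delta]$, where $k$ is as follows. (1) If $2\le\delta\le\frac{q^{t+1}+1}{\lambda}+\frac{2(q^t-1)}{\lambda}$, let $\upsilon=\lfloor\frac{q-2}{\lambda}\rfloor+\lfloor\frac{q}{\lambda}\rfloor$. Then $k=n-2m\epsilon$ if $2\le\delta\le\frac{q^{t+1}+1}{\lambda}-\lfloor\frac q\lambda\rfloor$; $k=n-2m\epsilon+2m\big(\delta-\frac{q^{t+1}+1}{\lambda}+\lfloor\frac q\lambda\rfloor\big)$ if $\frac{q^{t+1}+1}{\lambda}-\lfloor\frac q\lambda\rfloor<\delta\le\frac{q^{t+1}+1}{\lambda}+\lfloor\frac{q-2}{\lambda}\rfloor$; and $k=n-2m(\epsilon-\upsilon-1)$ if $\frac{q^{t+1}+1}{\lambda}+\lfloor\frac{q-2}{\lambda}\rfloor<\delta\le\frac{q^{t+1}+1}{\lambda}+\frac{2(q^t-1)}{\lambda}$. (2) If $\lfloor\frac{q-3}{\lambda}\rfloor\ne0$ and $\frac{q^{t+1}+1}{\lambda}+\frac{2(q^t-1)}{\lambda}<\delta\le\frac{q^{t+1}+1}{\lambda}+\frac{2(q^t-1)}{\lambda}+\lfloor\frac{q-3}{\lambda}\rfloor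 q^t$, then for an integer $a\in[0,\lfloor\frac{q-3}{\lambda}\rfloor-1]$: $k=n-2m(\epsilon-\upsilon-2a-2)$ if $\frac{q^{t+1}+1}{\lambda}+\frac{2(q^t-1)}{\lambda}+aq^t<\delta\le\frac{q^{t+1}+1}{\lambda}+(a+1)q^t$; and $k=n-2m(\epsilon-\upsilon-2a-3)$ if $\frac{q^{t+1}+1}{\lambda}+(a+1)q^t<\delta\le\frac{q^{t+1}+1}{\lambda}+\frac{2(q^t-1)}{\lambda}+(a+1)q^t$ (with $\upsilon$ as in (1)). (3) If $\frac{q^{t+1}+1}{\lambda}+\frac{2(q^t-1)}{\lambda}+\lfloor\frac{q-3}{\lambda}\rfloor q^t<\delta\le\frac{2q^{t+1}+2q-1}{\lambda}+1$, let $\kappa=2\frac{q^{t+1}+1}{\lambda}-\lfloor\frac{2q+1}{\lambda}\rfloor$ and $\tau=\lceil(\kappa-1)(1-q^{-1})\rceil$ (and $\upsilon$ as in (1)). (i) If $\lfloor\frac{q-1}{\lambda}\rfloor=\lfloor\frac{q-3}{\lambda}\rfloor$, then $k=n-2m(\epsilon-\upsilon-2\lfloor\frac{q-1}{\lambda}\rfloor-2)$ if $\frac{q^{t+1}+1}{\lambda}+\frac{2(q^t-1)}{\lambda}+\lfloor\frac{q-3}{\lambda}\rfloor q^t<\delta\le\kappa$, and $k=n-2m(\tau-\upsilon-2\lfloor\frac{q-1}{\lambda}\rfloor-2)$ if $\kappa<\delta\le\frac{2q^{t+1}+2q-1}{\lambda}+1$. (ii) If $\lfloor\frac{q-1}{\lambda}\rfloor=\lfloor\frac{q-3}{\lambda}\rfloor+1$,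 then $k=n-2m(\epsilon-\upsilon-2\lfloor\frac{q-1}{\lambda}\rfloor)$ if $\frac{q^{t+1}+1}{\lambda}+\frac{2(q^t-1)}{\lambda}+\lfloor\frac{q-3}{\lambda}\rfloor q^t<\delta\le\frac{q^{t+1}+1}{\lambda}+\lfloor\frac{q-1}{\lambda}\rfloor q^t$; $k=n-2m(\epsilon-\upsilon-2\lfloor\frac{q-1}{\lambda}\rfloor-1)$ if $\frac{q^{t+1}+1}{\lambda}+\lfloor\frac{q-1}{\lambda}\rfloor q^t<\delta\le\kappa$; and $k=n-2m(\tau-\upsilon-2\lfloor\frac{q-1}{\lambda}\rfloor-1)$ if $\kappa<\delta\le\frac{2q^{t+1}+2q-1}{\lambda}+1$.
   Context: Let $q$ be a prime power and $n\ge2$ an integer with $\gcd(n,q)=1$. Let $\ell=\mathrm{ord}_n(q)$, let $\alpha$ be a generator of $\mathbb{F}_{q^\ell}^*$, $\beta=\alpha^{(q^\ell-1)/n}$, and let $m_i(x)$ be the minimal polynomial of $\beta^i$ over $\mathbb{F}_q$. For integers $b\ge0$ and $2\le\delta\le n$, $\mathcal{C}_{(n,q,\delta,b)}$ denotes the cyclic (BCH) code of length $n$ over $\mathbb{F}_q$ with generator polynomial $\mathrm{lcm}(m_b(x),\dots,m_{b+\delta-2}(x))$. A linear code $\mathcal{C}$ is LCD if $\mathcal{C}\cap\mathcal{C}^\perp=\{0\}$ (Euclidean dual). $[n,k,d\ge D]$ means length $n$, dimension $k$, minimum Hamming distance at least $D$. *)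

theory Defs
  imports "HOL-Computational_Algebra.Polynomial" "HOL-Library.Function_Algebras" Complex_Main
begin

(* Vectors of length n over 'a are represented as functions nat => 'a vanishing outside {0..<n}. *)
definition vecs :: "nat \<Rightarrow> (nat \<Rightarrow> 'a::zero) set" where
  "vecs n = {v. \<forall>i\<ge>n. v i = 0}"

definition poly_of_vec :: "nat \<Rightarrow> (nat \<Rightarrow> 'a::zero) \<Rightarrow> 'a poly" where
  "poly_of_vec n v = Poly (map v [0..<n])"

definition is_field_emb :: "('a::field \<Rightarrow> 'b::field) \<Rightarrow> bool" where
  "is_field_emb e \<longleftrightarrow> inj e \<and> e 0 = 0 \<and> e 1 = 1 \<and>
     (\<forall>x y. e (x + y) = e x + e y) \<and> (\<forall>x y. e (x * y) = e x * e y)"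

definition min_poly :: "('a::field \<Rightarrow> 'b::field) \<Rightarrow> 'b \<Rightarrow> 'a poly" where
  "min_poly e x = (THE p. lead_coeff p = 1 \<and> poly (map_poly e p) x = 0 \<and>
       (\<forall>r. poly (map_poly e r) x = 0 \<longrightarrow> p dvd r))"

definition lcm_set :: "'a::field poly set \<Rightarrow> 'a poly" where
  "lcm_set S = (THE g. lead_coeff g = 1 \<and> (\<forall>f. (\<forall>p\<in>S. p dvd f) \<longleftrightarrow> g dvd f))"

definition cyclic_code :: "nat \<Rightarrow> 'a::field poly \<Rightarrow> (nat \<Rightarrow> 'a) set" where
  "cyclic_code n g = {v \<in> vecs n. g dvd poly_of_vec n v}"

definition bch_gen :: "('a::field \<Rightarrow> 'b::field) \<Rightarrow> 'b \<Rightarrow> nat \<Rightarrow> nat \<Rightarrow> 'a poly" where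
  "bch_gen e \<beta> \<delta> b = lcm_set ((\<lambda>i. min_poly e (\<beta> ^ i)) ` {b .. b + \<delta> - 2})"

definition bch_code :: "('a::field \<Rightarrow> 'b::field) \<Rightarrow> 'b \<Rightarrow> nat \<Rightarrow> nat \<Rightarrow> nat \<Rightarrow> (nat \<Rightarrow> 'a) set" where
  "bch_code e \<beta> n \<delta> b = cyclic_code n (bch_gen e \<beta> \<delta> b)"

definition hweight :: "nat \<Rightarrow> (nat \<Rightarrow> 'a::zero) \<Rightarrow> nat" where
  "hweight n v = card {i. i < n \<and> v i \<noteq> 0}"

definition min_dist_ge :: "nat \<Rightarrow> (nat \<Rightarrow> 'a::zero) set \<Rightarrow> nat \<Rightarrow> bool" where
  "min_dist_ge n C D \<longleftrightarrow> (\<forall>v\<in>C. v \<noteq> (\<lambda>_. 0) \<longrightarrow> hweight n v \<ge> D)"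

definition dual_code :: "nat \<Rightarrow> (nat \<Rightarrow> 'a::comm_ring) set \<Rightarrow> (nat \<Rightarrow> 'a) set" where
  "dual_code n C = {w \<in> vecs n. \<forall>v\<in>C. (\<Sum>i<n. v i * w i) = 0}"

definition is_LCD :: "nat \<Rightarrow> (nat \<Rightarrow> 'a::comm_ring) set \<Rightarrow> bool" where
  "is_LCD n C \<longleftrightarrow> C \<inter> dual_code n C = {\<lambda>_. 0}"

definition code_dim :: "(nat \<Rightarrow> 'a::field) set \<Rightarrow> nat" where
  "code_dim C = Vector_Spaces.vector_space.dim (\<lambda>c v. (\<lambda>i. c * v i)) C"

definition LCD_params :: "nat \<Rightarrow> (nat \<Rightarrow> 'a::field) set \<Rightarrow> int \<Rightarrow> nat \<Rightarrow> bool" where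
  "LCD_params n C k D \<longleftrightarrow> is_LCD n C \<and> int (code_dim C) = k \<and> min_dist_ge n C D"

end

theory Submission
  imports Defs "HOL-Number_Theory.Cong"
begin

text \<open>
  A cyclic code is the set of vectors whose discrete Fourier transform vanishes on a union of
  \<open>q\<close>-cyclotomic cosets modulo \<open>n\<close>, and its codimension is the size of that union. Since
  \<open>q ^ m\<close> is \<open>-1\<close> modulo \<open>n\<close>, cosets are closed under negation; this gives the LCD property and,
  for \<open>b = 0\<close>, \<open>2 * \<delta> - 1\<close> consecutive zeros, so the BCH bound yields \<open>2 * \<delta>\<close>.

  For the dimension, count the coset leaders \<open>i < \<delta>\<close>, each of which has a coset of full size
  \<open>2 * m\<close>. Multiply by \<open>\<lambda>\<close> to work with \<open>x = \<lambda> * i\<close> modulo \<open>q ^ m + 1\<close>. In the given range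
  two numbers prime to \<open>q\<close> in the same coset are equal or have the form
  \<open>k * q ^ (t + 1) + u\<close> and \<open>\<bar>k - u * q ^ t\<bar>\<close> with \<open>k \<in> {1, 2}\<close> and \<open>\<bar>u\<bar> < 2 * q\<close>. Hence the
  non-leaders are the multiples of \<open>q\<close>, everything from \<open>\<kappa>\<close> on (\<open>k = 2\<close>), a window around
  \<open>(q ^ (t + 1) + 1) / \<lambda>\<close>, and two arithmetic progressions of step \<open>q ^ t\<close> (\<open>k = 1\<close>).
\<close>

section \<open>Generator polynomials and cyclotomic cosets\<close>

text \<open>Multiplication by a nonzero \<open>x\<close> permutes the nonzero elements; cancelling
  the product of all of them leaves a power of \<open>x\<close> equal to 1.\<close>

lemma field_power_card_eq_same:
  fixes x :: "'a::{field,finite}"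
  shows "x ^ card (UNIV :: 'a set) = x"
proof (cases "x = 0")
  case False
  let ?c = "card (UNIV :: 'a set)"
  have c: "?c = Suc (card (UNIV - {0::'a}))"
    by (metis UNIV_I card_Suc_Diff1 finite)
  have "(\<lambda>y. x * y) ` (UNIV - {0}) = UNIV - {0}"
  proof (intro equalityI subsetI)
    fix y assume "y \<in> UNIV - {0::'a}"
    then show "y \<in> (\<lambda>y. x * y) ` (UNIV - {0})"
      using False by (intro image_eqI[of _ _ "y / x"]) auto
  qed (use False in auto)
  moreover have "inj_on (\<lambda>y. x * y) (UNIV - {0})"
    using False by (auto simp: inj_on_def)
  ultimately have "(\<Prod>y\<in>UNIV - {0}. x * y) = (\<Prod>y\<in>UNIV - {0}. y)"
    using prod.reindex[of "\<lambda>y. x * y" "UNIV - {0}" "\<lambda>y. y"] by simp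
  then have "x ^ card (UNIV - {0::'a}) * (\<Prod>y\<in>UNIV - {0}. y) = 1 * (\<Prod>y\<in>UNIV - {0::'a}. y)"
    by (simp add: prod.distrib)
  moreover have "(\<Prod>y\<in>UNIV - {0::'a}. y) \<noteq> 0" by simp
  ultimately have "x ^ card (UNIV - {0::'a}) = 1" using mult_right_cancel by blast
  then show ?thesis by (simp only: c power_Suc mult_1_right)
qed (simp add: finite_UNIV_card_ge_0)

lemma map_poly_hom_add:
  assumes "h 0 = 0" "\<And>x y. h (x + y) = h x + h y"
  shows "map_poly h (f + g) = map_poly h f + map_poly h g"
  by (rule poly_eqI) (simp add: coeff_map_poly assms)

lemma map_poly_hom_mult:
  fixes h :: "'a::comm_semiring_0 \<Rightarrow> 'b::comm_semiring_0"
  assumes "h 0 = 0" "\<And>x y. h (x + y) = h x + h y" "\<And>x y. h (x * y) = h x * h y"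
  shows "map_poly h (f * g) = map_poly h f * map_poly h g"
proof (rule poly_eqI)
  fix k
  have sum: "h (sum F A) = (\<Sum>i\<in>A. h (F i))" for F :: "nat \<Rightarrow> 'a" and A
    by (induction A rule: infinite_finite_induct) (auto simp: assms)
  show "coeff (map_poly h (f * g)) k = coeff (map_poly h f * map_poly h g) k"
    by (simp add: coeff_map_poly assms coeff_mult sum)
qed

lemma poly_eq_0_if_many_roots:
  fixes p :: "'a::idom poly"
  assumes "\<And>x. x \<in> R \<Longrightarrow> poly p x = 0" "degree p < card R"
  shows "p = 0"
proof (rule ccontr)
  assume "p \<noteq> 0"
  then have "card R \<le> card {x. poly p x = 0}"
    using assms(1) by (intro card_mono poly_roots_finite) auto
  with card_poly_roots_bound[OF \<open>p \<noteq> 0\<close>] assms(2) show False by simp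
qed

text \<open>Supplies the uniqueness behind the \<open>THE\<close> in \<open>min_poly\<close> and in
  \<open>lcm_set\<close>.\<close>

lemma monic_dvd_antisym:
  fixes p p' :: "'a::field poly"
  assumes "lead_coeff p = 1" "lead_coeff p' = 1" "p dvd p'" "p' dvd p"
  shows "p = p'"
proof -
  have "p \<noteq> 0" "p' \<noteq> 0" using assms by auto
  then have "degree p = degree p'" using assms by (intro antisym dvd_imp_degree_le) auto
  moreover obtain h where h: "p' = p * h" using assms by (auto simp: dvd_def)
  ultimately have "degree h = 0" using \<open>p \<noteq> 0\<close> \<open>p' \<noteq> 0\<close> by (auto simp: degree_mult_eq)
  then obtain c where c: "h = [:c:]" by (auto elim: degree_eq_zeroE)
  with h assms(1,2) \<open>p' \<noteq> 0\<close> have "c = 1" by (auto split: if_splits)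
  with h c show ?thesis by simp
qed

text \<open>The union of the \<open>q\<close>-cyclotomic cosets modulo \<open>n\<close> of the
  members of \<open>S\<close>. Since \<open>s\<close> runs over all naturals, the order of
  \<open>q\<close> modulo \<open>n\<close> need not be named.\<close>

definition q_cosets :: "nat \<Rightarrow> nat \<Rightarrow> nat set \<Rightarrow> nat set" where
  "q_cosets q n S = {(i * q ^ s) mod n |i s. i \<in> S}"

section \<open>Frobenius map and descent from the extension field\<close>

locale root_of_unity_ext =
  fixes e :: "'a::{field,finite} \<Rightarrow> 'b::field" and \<beta> :: 'b and q n :: nat
  assumes emb: "is_field_emb e" and card_eq: "card (UNIV :: 'a set) = q"
    and prime_power: "\<exists>p r. prime p \<and> 0 < r \<and> q = p ^ r"
    and coprime_qn: "coprime q n" and n_pos: "0 < n"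
    and root: "\<beta> ^ n = 1" and prim: "\<forall>j. 0 < j \<and> j < n \<longrightarrow> \<beta> ^ j \<noteq> 1"
begin

lemma e_simps [simp]:
  "e 0 = 0" "e 1 = 1" "e (x + y) = e x + e y" "e (x * y) = e x * e y" "e x = e y \<longleftrightarrow> x = y"
  using emb by (auto simp: is_field_emb_def inj_def)

lemma e_eq_0_iff [simp]: "e x = 0 \<longleftrightarrow> x = 0"
  using e_simps(5)[of x 0] by (simp del: e_simps(5))

lemma e_power: "e (x ^ k) = e x ^ k" by (induction k) auto

lemma e_sum: "e (sum f A) = (\<Sum>i\<in>A. e (f i))"
  by (induction A rule: infinite_finite_induct) auto

lemma beta_nz [simp]: "\<beta> \<noteq> 0"
  using root n_pos by (auto simp: power_0_left)

lemma char_e: "CHAR('b) = CHAR('a)"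
proof (rule CHAR_eqI)
  have of_nat: "of_nat k = e (of_nat k)" for k by (induction k) auto
  show "of_nat CHAR('a) = (0::'b)" by (simp add: of_nat)
  show "CHAR('a) dvd x" if "of_nat x = (0::'b)" for x
    using that by (simp add: of_nat of_nat_eq_0_iff_char_dvd)
qed

lemma frobenius_add: "(x + y) ^ q = x ^ q + (y ^ q :: 'b)"
proof -
  obtain p r where pr: "prime p" "q = p ^ r" using prime_power by blast
  \<comment> \<open>Translation by 1 permutes the field, so \<open>q\<close> times 1 is 0; the
    characteristic is thus a prime dividing \<open>q\<close>, namely \<open>p\<close>.\<close>
  have "(\<Sum>y\<in>UNIV. y + 1) = (\<Sum>y\<in>UNIV. y :: 'a)"
    by (rule sum.reindex_bij_witness[of _ "\<lambda>y. y - 1" "\<lambda>y. y + 1"]) auto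
  then have "of_nat (card (UNIV :: 'a set)) = (0::'a)" by (simp add: sum.distrib)
  then have "CHAR('a) dvd p ^ r" using card_eq pr of_nat_eq_0_iff_char_dvd by metis
  moreover have "prime CHAR('a)"
    using prime_CHAR_semidom[where ?'a='a] finite_imp_CHAR_pos[where ?'a='a] by simp
  ultimately have "CHAR('a) = p" using pr prime_dvd_power primes_dvd_imp_eq by blast
  then show ?thesis
    using freshmans_dream'[where ?'a='b, of q r x y] pr by (simp add: char_e)
qed

lemma q_pos: "0 < q" using card_eq finite_UNIV_card_ge_0[where ?'a='a] by simp

lemma e_power_q: "e a ^ q = e a"
  using field_power_card_eq_same[of a] e_power[of a q] card_eq by simp

text \<open>The image of \<open>e\<close> already provides \<open>q\<close> roots of X^q - X, a
  polynomial with at most \<open>q\<close> roots.\<close>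

lemma range_e: "range e = {y. y ^ q = y}"
proof (rule card_seteq)
  obtain p r where "prime p" "0 < r" "q = p ^ r" using prime_power by blast
  then have q1: "1 < q" using one_less_power[of p r] prime_gt_1_nat by simp
  let ?P = "monom 1 q - monom 1 1 :: 'b poly"
  have "coeff ?P q = 1" using q1 by simp
  then have P: "?P \<noteq> 0" by (metis coeff_0 zero_neq_one)
  have eq: "{y. y ^ q = y} = {y. poly ?P y = 0}" by (auto simp: poly_monom)
  show "finite {y::'b. y ^ q = y}" unfolding eq by (rule poly_roots_finite[OF P])
  have "degree ?P \<le> q" using q1 by (intro degree_diff_le) (auto simp: degree_monom_eq)
  then have "card {y::'b. y ^ q = y} \<le> q"
    unfolding eq using card_poly_roots_bound[OF P] by simp
  also have "q = card (range e)"
    using emb card_eq by (simp add: is_field_emb_def card_image)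
  finally show "card {y::'b. y ^ q = y} \<le> card (range e)" .
  show "range e \<subseteq> {y. y ^ q = y}" using e_power_q by auto
qed

lemma beta_power_mod: "\<beta> ^ (k mod n) = \<beta> ^ k"
proof -
  have "\<beta> ^ k = \<beta> ^ (n * (k div n) + k mod n)" by simp
  also have "\<dots> = \<beta> ^ (k mod n)" by (simp only: power_add power_mult root) simp
  finally show ?thesis by simp
qed

lemma inj_beta: "inj_on (\<lambda>j. \<beta> ^ j) {..<n}"
proof (rule linorder_inj_onI)
  fix i j assume "i < j" "i \<in> {..<n}" "j \<in> {..<n}"
  then have "0 < j - i" "j - i < n" by auto
  then have "\<beta> ^ (j - i) \<noteq> 1" using prim by blast
  moreover have "\<beta> ^ j = \<beta> ^ i * \<beta> ^ (j - i)" using \<open>i < j\<close> by (simp flip: power_add)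
  ultimately show "\<beta> ^ i \<noteq> \<beta> ^ j" by auto
qed auto

lemma beta_power_eq_1_iff: "\<beta> ^ k = 1 \<longleftrightarrow> n dvd k"
proof -
  have "\<beta> ^ k = 1 \<longleftrightarrow> \<beta> ^ (k mod n) = \<beta> ^ 0" by (simp add: beta_power_mod)
  also have "\<dots> \<longleftrightarrow> k mod n = 0"
    using inj_on_eq_iff[OF inj_beta, of "k mod n" 0] n_pos by simp
  finally show ?thesis by (simp only: dvd_eq_mod_eq_0)
qed

abbreviation ev :: "'a poly \<Rightarrow> 'b \<Rightarrow> 'b" where "ev f x \<equiv> poly (map_poly e f) x"

lemma ev_add: "ev (f + g) x = ev f x + ev g x"
  by (simp add: map_poly_hom_add)

lemma ev_mult: "ev (f * g) x = ev f x * ev g x"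
  by (simp add: map_poly_hom_mult)

lemma poly_frobenius: "poly (map_poly (\<lambda>c. c ^ q) F) (x ^ q) = poly F x ^ q" for F :: "'b poly"
proof (induction F)
  case (pCons a F)
  have "(0::'b) ^ q = 0" using q_pos by (simp add: power_0_left)
  then show ?case by (simp add: map_poly_pCons frobenius_add power_mult_distrib pCons.IH)
qed (use q_pos in \<open>simp add: power_0_left\<close>)

lemma ev_frobenius: "ev f (x ^ q) = ev f x ^ q"
proof -
  have "map_poly (\<lambda>c. c ^ q) (map_poly e f) = map_poly e f"
    using q_pos by (intro poly_eqI) (simp add: coeff_map_poly e_power_q)
  then show ?thesis using poly_frobenius[of "map_poly e f" x] by simp
qed

lemma ev_frobenius_iterate: "ev f (x ^ (q ^ s)) = ev f x ^ (q ^ s)"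
proof (induction s)
  case (Suc s)
  have "ev f (x ^ (q ^ Suc s)) = ev f ((x ^ (q ^ s)) ^ q)"
    by (simp only: power_Suc2 power_mult)
  also have "\<dots> = ev f x ^ (q ^ Suc s)"
    by (simp only: ev_frobenius Suc.IH power_Suc2 power_mult)
  finally show ?case .
qed simp

text \<open>Coefficients fixed by the Frobenius map lie in \<open>range e\<close>, so the polynomial
  descends.\<close>

lemma map_poly_e_surj:
  assumes "\<And>k. coeff G k ^ q = coeff G k"
  shows "\<exists>g. map_poly e g = G"
proof
  have inv0: "inv e 0 = 0" using inv_f_f[of e 0] emb by (simp add: is_field_emb_def)
  show "map_poly e (map_poly (inv e) G) = G"
  proof (rule poly_eqI)
    fix k
    have "coeff G k \<in> range e" using assms range_e by auto
    then show "coeff (map_poly e (map_poly (inv e) G)) k = coeff G k"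
      by (simp add: coeff_map_poly inv0 f_inv_into_f)
  qed
qed

text \<open>The product of the linear factors over \<open>T\<close> is monic of the right degree.
  Multiplication by \<open>q\<close> permutes \<open>T\<close>, so the Frobenius map fixes its
  coefficients and it descends to \<open>'a\<close>.\<close>

lemma vanishing_poly_exists:
  assumes T: "T \<subseteq> {..<n}" and closed: "\<And>j. j \<in> T \<Longrightarrow> (j * q) mod n \<in> T"
  shows "\<exists>g. lead_coeff g = 1 \<and> degree g = card T \<and> (\<forall>f. g dvd f \<longleftrightarrow> (\<forall>j\<in>T. ev f (\<beta> ^ j) = 0))"
proof -
  have fin: "finite T" using T finite_subset by blast
  define G where "G = (\<Prod>j\<in>T. [:- (\<beta> ^ j), 1:])"
  have inj: "inj_on (\<lambda>j. (j * q) mod n) T"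
  proof (rule inj_onI)
    fix i j assume ij: "i \<in> T" "j \<in> T" "(i * q) mod n = (j * q) mod n"
    then have "[i = j] (mod n)"
      using coprime_qn by (metis cong_def cong_mult_rcancel_nat)
    moreover have "i < n" "j < n" using ij T by auto
    ultimately show "i = j" by (simp add: cong_def)
  qed
  have bij: "(\<lambda>j. (j * q) mod n) ` T = T"
    by (rule endo_inj_surj[OF fin _ inj]) (use closed in auto)
  \<comment> \<open>Derived from additivity, which avoids a distinction by the parity of
    \<open>q\<close>.\<close>
  have neg: "(- x) ^ q = - (x ^ q)" for x :: 'b
  proof -
    have "(x + - x) ^ q = x ^ q + (- x) ^ q" by (rule frobenius_add)
    then have "(- x) ^ q + x ^ q = 0" using q_pos by (simp add: add.commute power_0_left)
    then show ?thesis by (simp only: eq_neg_iff_add_eq_0)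
  qed
  have prodmap: "map_poly (\<lambda>c. c ^ q) (\<Prod>j\<in>A. [:- (\<beta> ^ j), 1:]) = (\<Prod>j\<in>A. [:- (\<beta> ^ (j * q)), 1:])" 
    if "finite A" for A
    using that
  proof (induction A rule: finite_induct)
    case (insert a A)
    have "(0::'b) ^ q = 0" using q_pos by (simp add: power_0_left)
    then have "map_poly (\<lambda>c. c ^ q) ([:- (\<beta> ^ a), 1:] * F) = [:- (\<beta> ^ (a * q)), 1:] * map_poly (\<lambda>c. c ^ q) F" for F
      by (subst map_poly_hom_mult)
        (simp_all only: map_poly_pCons frobenius_add power_mult_distrib neg power_mult power_one map_poly_0)
    then show ?case
      by (simp only: prod.insert[OF insert.hyps] insert.IH)
  qed (simp add: map_poly_1)
  have "map_poly (\<lambda>c. c ^ q) G = (\<Prod>j\<in>T. [:- (\<beta> ^ ((j * q) mod n)), 1:])"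
    unfolding G_def prodmap[OF fin] by (simp add: beta_power_mod)
  also have "\<dots> = (\<Prod>j\<in>(\<lambda>j. (j * q) mod n) ` T. [:- (\<beta> ^ j), 1:])"
    by (simp add: prod.reindex[OF inj])
  also have "\<dots> = G" by (simp add: bij G_def)
  finally have fixed: "map_poly (\<lambda>c. c ^ q) G = G" .
  have "coeff G k ^ q = coeff G k" for k
    using arg_cong[OF fixed, of "\<lambda>f. coeff f k"] q_pos by (simp add: coeff_map_poly)
  then obtain g where g: "map_poly e g = G" using map_poly_e_surj by blast
  have degG: "degree G = card T"
    unfolding G_def by (subst degree_prod_eq_sum_degree) auto
  have leadG: "lead_coeff G = 1" unfolding G_def by (simp add: lead_coeff_prod)
  have deg: "degree g = card T" using degG g by (metis degree_map_poly e_eq_0_iff)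
  have "e (lead_coeff g) = e 1" using leadG degG deg by (simp add: g[symmetric] coeff_map_poly)
  then have lead: "lead_coeff g = 1" using e_simps(5)[of "lead_coeff g" 1] by blast
  have root_g: "ev g (\<beta> ^ j) = 0" if "j \<in> T" for j
    using that fin by (auto simp: g G_def poly_prod)
  have "g dvd f \<longleftrightarrow> (\<forall>j\<in>T. ev f (\<beta> ^ j) = 0)" for f
  proof
    assume "g dvd f"
    then obtain h where "f = g * h" by (auto simp: dvd_def)
    then show "\<forall>j\<in>T. ev f (\<beta> ^ j) = 0" using root_g by (simp add: ev_mult)
  next
    assume v: "\<forall>j\<in>T. ev f (\<beta> ^ j) = 0"
    \<comment> \<open>For nonempty \<open>T\<close>, a nonzero remainder would have degree below
      \<open>card T\<close> but vanish at \<open>card T\<close> distinct powers of \<beta>.\<close>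
    define h where "h = f mod g"
    have f: "g * (f div g) + h = f" by (simp add: h_def)
    have hv: "ev h (\<beta> ^ j) = 0" if "j \<in> T" for j
      using v root_g[OF that] that ev_add[of "g * (f div g)" h "\<beta> ^ j"]
      unfolding f ev_mult by simp
    have "h = 0"
    proof (cases "degree g = 0")
      case True
      then obtain c where "g = [:c:]" by (rule degree_eq_zeroE)
      with lead have "is_unit g" by (simp flip: one_pCons)
      then have "g dvd f" using dvd_trans one_dvd by blast
      then show ?thesis by (simp add: h_def)
    next
      case False
      show ?thesis
      proof (rule ccontr)
        assume "h \<noteq> 0"
        moreover have "degree h < degree g"
          using False degree_mod_less'[of g f] \<open>h \<noteq> 0\<close> by (cases "g = 0") (auto simp: h_def)
        moreover have "card ((\<lambda>j. \<beta> ^ j) ` T) = card T"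
          by (rule card_image[OF inj_on_subset[OF inj_beta T]])
        ultimately have "map_poly e h = 0"
          using hv by (intro poly_eq_0_if_many_roots[of "(\<lambda>j. \<beta> ^ j) ` T"])
            (auto simp: degree_map_poly deg)
        with \<open>h \<noteq> 0\<close> show False by (simp add: map_poly_eq_0_iff)
      qed
    qed
    then show "g dvd f" by (simp add: h_def mod_eq_0_iff_dvd)
  qed
  with lead deg show ?thesis by blast
qed

section \<open>Zeros along cyclotomic cosets and the generator polynomial\<close>

abbreviation cosets :: "nat set \<Rightarrow> nat set" where "cosets \<equiv> q_cosets q n"

lemma cosets_subset: "cosets S \<subseteq> {..<n}"
  using n_pos by (auto simp: q_cosets_def)

text \<open>The value at \<open>\<beta> ^ (i * q ^ s)\<close> is a power of the value at
  \<open>\<beta> ^ i\<close>, so zeros spread over whole cosets.\<close>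

lemma ev_cosets: "(\<forall>j\<in>cosets S. ev f (\<beta> ^ j) = 0) \<longleftrightarrow> (\<forall>i\<in>S. ev f (\<beta> ^ i) = 0)"
proof
  assume L: "\<forall>j\<in>cosets S. ev f (\<beta> ^ j) = 0"
  show "\<forall>i\<in>S. ev f (\<beta> ^ i) = 0"
  proof
    fix i assume "i \<in> S"
    then have "(i * q ^ 0) mod n \<in> cosets S" unfolding q_cosets_def by blast
    then have "ev f (\<beta> ^ (i mod n)) = 0" using L by (metis power_0 mult_1_right)
    then show "ev f (\<beta> ^ i) = 0" by (simp add: beta_power_mod)
  qed
next
  assume R: "\<forall>i\<in>S. ev f (\<beta> ^ i) = 0"
  show "\<forall>j\<in>cosets S. ev f (\<beta> ^ j) = 0"
  proof
    fix j assume "j \<in> cosets S"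
    then obtain i s where i: "i \<in> S" "j = (i * q ^ s) mod n" unfolding q_cosets_def by blast
    have "ev f (\<beta> ^ j) = ev f ((\<beta> ^ i) ^ (q ^ s))"
      by (simp only: i(2) beta_power_mod power_mult)
    also have "\<dots> = ev f (\<beta> ^ i) ^ (q ^ s)" by (rule ev_frobenius_iterate)
    also have "\<dots> = 0" using R i(1) q_pos by (simp add: power_0_left)
    finally show "ev f (\<beta> ^ j) = 0" .
  qed
qed

text \<open>Used with \<open>S = {i}\<close> for minimal polynomials and with an interval for the
  generator polynomial, whose degree is the codimension of the code.\<close>

lemma coset_poly_exists:
  "\<exists>g. lead_coeff g = 1 \<and> degree g = card (cosets S) \<and>
     (\<forall>f. g dvd f \<longleftrightarrow> (\<forall>i\<in>S. ev f (\<beta> ^ i) = 0))"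
proof -
  have "(j * q) mod n \<in> cosets S" if jS: "j \<in> cosets S" for j
  proof -
    obtain i s where "i \<in> S" "j = (i * q ^ s) mod n"
      using jS unfolding q_cosets_def by blast
    then have "(j * q) mod n = (i * q ^ Suc s) mod n" by (simp add: mod_simps mult_ac)
    with \<open>i \<in> S\<close> show ?thesis unfolding q_cosets_def by blast
  qed
  from vanishing_poly_exists[OF cosets_subset this]
  show ?thesis by (simp only: ev_cosets)
qed

lemma min_poly_dvd_iff: "min_poly e (\<beta> ^ i) dvd f \<longleftrightarrow> ev f (\<beta> ^ i) = 0"
proof -
  obtain g where g: "lead_coeff g = 1" "\<And>f. g dvd f \<longleftrightarrow> ev f (\<beta> ^ i) = 0"
  proof -
    obtain g where "lead_coeff g = 1" "\<forall>f. g dvd f \<longleftrightarrow> (\<forall>i\<in>{i}. ev f (\<beta> ^ i) = 0)"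
      using coset_poly_exists[of "{i}"] by (elim exE conjE)
    then show thesis using that[of g] by (simp only: singleton_iff ball_simps) simp
  qed
  have "min_poly e (\<beta> ^ i) = g"
    unfolding min_poly_def
  proof (rule the_equality)
    show "lead_coeff g = 1 \<and> ev g (\<beta> ^ i) = 0 \<and> (\<forall>r. ev r (\<beta> ^ i) = 0 \<longrightarrow> g dvd r)"
      using g(1) g(2)[of g] by (intro conjI allI impI) (simp_all add: g(2)[symmetric])
    fix p assume p: "lead_coeff p = 1 \<and> ev p (\<beta> ^ i) = 0 \<and> (\<forall>r. ev r (\<beta> ^ i) = 0 \<longrightarrow> p dvd r)"
    then have "g dvd p" "p dvd g" using g(2)[of p] g(2)[of g] by simp_all
    then show "p = g" using p g(1) monic_dvd_antisym by blast
  qed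
  with g(2) show ?thesis by (simp only:)
qed

text \<open>Divisibility by all the minimal polynomials means vanishing at all the listed powers.
  Hence the lcm and the polynomial of \<open>coset_poly_exists\<close> are monic with the same
  multiples, and so equal.\<close>

lemma bch_gen_props:
  shows lead_coeff_bch_gen: "lead_coeff (bch_gen e \<beta> \<delta> b) = 1"
    and degree_bch_gen: "degree (bch_gen e \<beta> \<delta> b) = card (cosets {b..b + \<delta> - 2})"
    and bch_gen_dvd_iff: "bch_gen e \<beta> \<delta> b dvd f \<longleftrightarrow> (\<forall>i\<in>{b..b + \<delta> - 2}. ev f (\<beta> ^ i) = 0)"
proof -
  obtain g where g: "lead_coeff g = 1" "degree g = card (cosets {b..b + \<delta> - 2})"
      "\<forall>f. g dvd f \<longleftrightarrow> (\<forall>i\<in>{b..b + \<delta> - 2}. ev f (\<beta> ^ i) = 0)"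
    using coset_poly_exists[of "{b..b + \<delta> - 2}"] by (elim exE conjE)
  have "bch_gen e \<beta> \<delta> b = g"
    unfolding bch_gen_def lcm_set_def
  proof (rule the_equality)
    show "lead_coeff g = 1 \<and>
      (\<forall>f. (\<forall>p\<in>(\<lambda>i. min_poly e (\<beta> ^ i)) ` {b..b + \<delta> - 2}. p dvd f) = (g dvd f))"
      using g(1,3) by (simp only: min_poly_dvd_iff ball_simps) blast
    fix g' assume g': "lead_coeff g' = 1 \<and>
      (\<forall>f. (\<forall>p\<in>(\<lambda>i. min_poly e (\<beta> ^ i)) ` {b..b + \<delta> - 2}. p dvd f) = (g' dvd f))"
    then have iff: "g' dvd f \<longleftrightarrow> g dvd f" for f using g(3) by (simp only: min_poly_dvd_iff ball_simps)
    have "g' dvd g" "g dvd g'" using iff[of g] iff[of g'] by simp_all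
    then show "g' = g" using g' g(1) monic_dvd_antisym by blast
  qed
  with g show "lead_coeff (bch_gen e \<beta> \<delta> b) = 1"
    "degree (bch_gen e \<beta> \<delta> b) = card (cosets {b..b + \<delta> - 2})"
    "bch_gen e \<beta> \<delta> b dvd f \<longleftrightarrow> (\<forall>i\<in>{b..b + \<delta> - 2}. ev f (\<beta> ^ i) = 0)"
    by (simp_all only:)
qed

end

section \<open>Dimension, duality and distance\<close>

lemma poly_of_vec_altdef: "poly_of_vec n v = (\<Sum>k<n. monom (v k) k)"
  by (rule poly_eqI) (auto simp: poly_of_vec_def coeff_sum nth_default_def)

lemma coeff_poly_of_vec: "coeff (poly_of_vec n v) k = (if k < n then v k else 0)"
  by (simp add: poly_of_vec_def nth_default_def)

lemma poly_of_vec_coeff: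
  assumes "\<And>k. n \<le> k \<Longrightarrow> coeff p k = 0"
  shows "poly_of_vec n (coeff p) = p"
  by (rule poly_eqI) (use assms in \<open>auto simp: coeff_poly_of_vec\<close>)

lemma sum_fun_apply: "(\<Sum>i\<in>A. f i) x = (\<Sum>i\<in>A. f i x)"
  for f :: "'i \<Rightarrow> 'x \<Rightarrow> 'y::comm_monoid_add"
  by (induction A rule: infinite_finite_induct) auto

text \<open>The products of \<open>g\<close> with \<open>monom 1 k\<close> for
  \<open>k < n - degree g\<close> form a basis: a multiple of \<open>g\<close> of degree below
  \<open>n\<close> has a cofactor of degree below that bound, and cancelling \<open>g\<close> gives
  independence.\<close>

lemma code_dim_cyclic_code:
  fixes g :: "'a::field poly"
  assumes g: "g \<noteq> 0" "degree g \<le> n"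
  shows "code_dim (cyclic_code n g) = n - degree g"
proof -
  interpret vs: vector_space "\<lambda>(c::'a) (v::nat \<Rightarrow> 'a). (\<lambda>i. c * v i)"
    by unfold_locales (auto simp: fun_eq_iff algebra_simps)
  let ?k = "n - degree g"
  define b where "b = (\<lambda>k. coeff (monom 1 k * g))"
  have comb: "(\<Sum>k<?k. (\<lambda>i. c k * b k i)) = coeff ((\<Sum>k<?k. monom (c k) k) * g)" for c
  proof
    fix i
    have "monom (c k) k * g = smult (c k) (monom 1 k * g)" for k
      by (metis mult.right_neutral mult_smult_left smult_monom)
    then show "(\<Sum>k<?k. (\<lambda>i. c k * b k i)) i = coeff ((\<Sum>k<?k. monom (c k) k) * g) i"
      by (simp add: sum_fun_apply b_def sum_distrib_right coeff_sum)
  qed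
  have inj: "inj_on b {..<?k}"
  proof (rule inj_onI)
    fix k l assume "b k = b l"
    then have "monom 1 k * g = monom 1 l * g" by (simp add: b_def coeff_inject)
    then have "monom (1::'a) k = monom 1 l" using g by simp
    then have "degree (monom (1::'a) k) = degree (monom (1::'a) l)" by simp
    then show "k = l" by (simp add: degree_monom_eq)
  qed
  have "vs.dim (cyclic_code n g) = ?k"
  proof (rule vs.dim_unique[of "b ` {..<?k}"])
    show "b ` {..<?k} \<subseteq> cyclic_code n g"
    proof (intro image_subsetI)
      fix k assume "k \<in> {..<?k}"
      then have "degree (monom 1 k * g) < n"
        using g by (auto simp: degree_mult_eq degree_monom_eq monom_eq_0_iff)
      then have z: "coeff (monom 1 k * g) i = 0" if "n \<le> i" for i
        using that by (intro coeff_eq_0) simp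
      show "b k \<in> cyclic_code n g"
        using z poly_of_vec_coeff[of n "monom 1 k * g"] by (simp add: cyclic_code_def vecs_def b_def)
    qed
    show "cyclic_code n g \<subseteq> vs.span (b ` {..<?k})"
    proof
      fix v assume v: "v \<in> cyclic_code n g"
      then obtain h where h: "poly_of_vec n v = g * h" by (auto simp: cyclic_code_def dvd_def)
      have vc: "v = coeff (poly_of_vec n v)"
        using v by (auto simp: fun_eq_iff coeff_poly_of_vec cyclic_code_def vecs_def)
      have "coeff h k = 0" if "?k \<le> k" for k
      proof (cases "h = 0")
        case False
        have "degree g + degree h = degree (g * h)" using False g by (simp add: degree_mult_eq)
        also have "\<dots> < n"
        proof (rule ccontr)
          assume "\<not> degree (g * h) < n"
          then have "lead_coeff (g * h) = 0" by (simp flip: h add: coeff_poly_of_vec)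
          then have "g * h = 0" by (simp only: leading_coeff_0_iff)
          with False g show False by simp
        qed
        finally show ?thesis using that by (intro coeff_eq_0) simp
      qed simp
      then have hsum: "(\<Sum>k<?k. monom (coeff h k) k) = h"
        using poly_of_vec_coeff[of ?k h] by (simp add: poly_of_vec_altdef)
      have "v = (\<Sum>k<?k. (\<lambda>i. coeff h k * b k i))"
        by (subst vc) (simp only: comb hsum h mult.commute)
      also have "\<dots> \<in> vs.span (b ` {..<?k})"
        by (intro vs.span_sum vs.span_scale vs.span_base) auto
      finally show "v \<in> vs.span (b ` {..<?k})" .
    qed
    show "\<not> vs.dependent (b ` {..<?k})"
    proof (rule vs.independent_if_scalars_zero)
      fix f x assume s: "(\<Sum>x\<in>b ` {..<?k}. (\<lambda>i. f x * x i)) = 0" and x: "x \<in> b ` {..<?k}"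
      then obtain k where k: "k < ?k" "x = b k" by auto
      have "coeff ((\<Sum>k<?k. monom (f (b k)) k) * g) = coeff 0"
        using s inj by (simp add: sum.reindex comb fun_eq_iff)
      then have "(\<Sum>k<?k. monom (f (b k)) k) = 0" using g by (simp add: coeff_inject)
      then have "coeff (\<Sum>k<?k. monom (f (b k)) k) k = 0" by simp
      then show "f x = 0" using k by (simp add: coeff_sum)
    qed simp
    show "card (b ` {..<?k}) = ?k" using card_image[OF inj] by simp
  qed
  then show ?thesis by (simp add: code_dim_def)
qed

text \<open>Reflection of the residue \<open>i\<close> to \<open>s - i\<close> is an involution; the
  summands \<open>n\<close> keep subtraction on naturals from truncating.\<close>

lemma minus_mod_self_inverse:
  fixes s i n :: nat
  assumes "s < n" "i < n"
  shows "(s + n - (s + n - i) mod n) mod n = i"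
proof (cases "i \<le> s")
  case True
  have "(s + n - i) mod n = ((s - i) + n) mod n" using True by simp
  also have "\<dots> = s - i" using assms by (simp only: mod_add_self2) simp
  finally have r: "(s + n - i) mod n = s - i" .
  have "s + n - (s - i) = i + n" using True assms by simp
  then show ?thesis unfolding r using assms by (simp only: mod_add_self2) simp
next
  case False
  then have r: "(s + n - i) mod n = s + n - i" using assms by simp
  have "s + n - (s + n - i) = i" using assms by simp
  then show ?thesis unfolding r using assms by simp
qed

section \<open>Fourier transform, duality and distance bounds\<close>

context root_of_unity_ext
begin

definition dft :: "(nat \<Rightarrow> 'a) \<Rightarrow> nat \<Rightarrow> 'b" where
  "dft v j = (\<Sum>k<n. e (v k) * \<beta> ^ (j * k))"

lemma ev_poly_of_vec: "ev (poly_of_vec n v) (\<beta> ^ j) = dft v j"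
proof -
  have "map_poly e (\<Sum>k\<in>A. monom (v k) k) = (\<Sum>k\<in>A. monom (e (v k)) k)" for A
    by (induction A rule: infinite_finite_induct) (simp_all add: map_poly_hom_add map_poly_monom)
  then show ?thesis
    by (simp add: poly_of_vec_altdef dft_def poly_sum poly_monom power_mult)
qed

lemma beta_power_cong: "[i = j] (mod n) \<Longrightarrow> \<beta> ^ i = \<beta> ^ j"
  by (metis beta_power_mod cong_def)

lemma dft_cong: "[i = j] (mod n) \<Longrightarrow> dft v i = dft v j"
  unfolding dft_def by (intro sum.cong refl arg_cong2[where f="(*)"] beta_power_cong cong_scalar_right)

lemma bch_code_iff:
  "v \<in> bch_code e \<beta> n \<delta> b \<longleftrightarrow> v \<in> vecs n \<and> (\<forall>i\<in>{b..b + \<delta> - 2}. dft v i = 0)"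
  by (simp only: bch_code_def cyclic_code_def mem_Collect_eq bch_gen_dvd_iff ev_poly_of_vec)

lemma dft_coset:
  assumes "dft v i = 0"
  shows "dft v (i * q ^ s) = 0"
proof -
  have "dft v (i * q ^ s) = dft v i ^ (q ^ s)"
    by (simp only: ev_poly_of_vec[symmetric] power_mult ev_frobenius_iterate)
  then show ?thesis using assms q_pos by (simp add: power_0_left)
qed

text \<open>The transform is injective: a polynomial of degree below \<open>n\<close> with
  \<open>n\<close> distinct roots is zero.\<close>

lemma dft_eq_0_imp:
  assumes "v \<in> vecs n" "\<And>j. j < n \<Longrightarrow> dft v j = 0"
  shows "v = (\<lambda>_. 0)"
proof -
  have "degree (poly_of_vec n v) < n"
    using n_pos by (intro degree_lessI) (auto simp: coeff_poly_of_vec)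
  then have "map_poly e (poly_of_vec n v) = 0"
    using assms(2) card_image[OF inj_beta]
    by (intro poly_eq_0_if_many_roots[of "(\<lambda>j. \<beta> ^ j) ` {..<n}"])
      (auto simp: degree_map_poly ev_poly_of_vec)
  then have "poly_of_vec n v = 0" by (simp add: map_poly_eq_0_iff)
  then have "coeff (poly_of_vec n v) k = 0" for k by simp
  then show ?thesis using assms(1)
    by (auto simp: fun_eq_iff vecs_def coeff_poly_of_vec split: if_splits) (metis not_less)
qed

text \<open>Both sides are inverse to \<open>\<beta> ^ (j * k)\<close>, the right one because
  \<open>q ^ h\<close> is -1 modulo \<open>n\<close>.\<close>

lemma beta_power_minus:
  assumes "n dvd q ^ h + 1" "k \<le> n"
  shows "\<beta> ^ (j * (n - k)) = \<beta> ^ (j * q ^ h * k)"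
proof -
  have "\<beta> ^ (j * (n - k)) * \<beta> ^ (j * k) = \<beta> ^ (n * j)"
    using assms(2) by (simp add: mult.commute flip: power_add add_mult_distrib2)
  also have "\<dots> = 1" by (simp add: power_mult root)
  also have "1 = \<beta> ^ (j * k * (q ^ h + 1))"
    using assms(1) by (subst eq_commute) (simp only: beta_power_eq_1_iff dvd_mult)
  also have "\<dots> = \<beta> ^ (j * q ^ h * k) * \<beta> ^ (j * k)"
    by (simp add: algebra_simps flip: power_add)
  finally show ?thesis by simp
qed

text \<open>Reversed cyclic shifts of \<open>w\<close> lie in the code again, so orthogonality makes the cyclic
  convolution of \<open>w\<close> with itself vanish, whence all squares \<open>(dft w j)\<^sup>2\<close> vanish.\<close>

lemma is_LCD_bch_code:
  assumes h: "n dvd q ^ h + 1"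
  shows "is_LCD n (bch_code e \<beta> n \<delta> b)"
proof -
  let ?C = "bch_code e \<beta> n \<delta> b"
  have "w = (\<lambda>_. 0)" if w: "w \<in> ?C" "w \<in> dual_code n ?C" for w
  proof (rule dft_eq_0_imp)
    show "w \<in> vecs n" using w by (simp add: bch_code_iff)
    define r where "r = (\<lambda>s i. (s + n - i) mod n)"
    have r_lt: "r s i < n" for s i using n_pos by (simp add: r_def)
    have rr: "r s (r s i) = i" if "s < n" "i < n" for s i
      using minus_mod_self_inverse[OF that] by (simp add: r_def)
    have conv: "(\<Sum>i<n. w i * w (r s i)) = 0" if s: "s < n" for s
    proof -
      \<comment> \<open>Reversal evaluates \<open>w\<close> at the exponent -j, that is at
        \<open>j * q ^ h\<close> modulo \<open>n\<close>. This lies in the coset of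
        \<open>j\<close>, so \<open>u\<close> has all the zeros required by the code.\<close>
      define u where "u = (\<lambda>i. if i < n then w (r s i) else 0)"
      have "dft u j = 0" if j: "j \<in> {b..b + \<delta> - 2}" for j
      proof -
        have "dft u j = (\<Sum>i<n. e (w (r s i)) * \<beta> ^ (j * i))" by (simp add: dft_def u_def)
        also have "\<dots> = (\<Sum>k<n. e (w k) * \<beta> ^ (j * r s k))"
          by (rule sum.reindex_bij_witness[of _ "r s" "r s"]) (auto simp: r_lt rr s)
        also have "\<dots> = (\<Sum>k<n. \<beta> ^ (j * s) * (e (w k) * \<beta> ^ (j * q ^ h * k)))"
        proof (intro sum.cong refl)
          fix k assume "k \<in> {..<n}"
          then have k: "k \<le> n" by simp
          have "[j * r s k = j * (s + n - k)] (mod n)"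
            unfolding r_def by (intro cong_scalar_left) (simp add: cong_def)
          then have "\<beta> ^ (j * r s k) = \<beta> ^ (j * (s + n - k))" by (rule beta_power_cong)
          also have "\<dots> = \<beta> ^ (j * s) * \<beta> ^ (j * (n - k))"
            using k by (simp flip: power_add add_mult_distrib2)
          finally show "e (w k) * \<beta> ^ (j * r s k) = \<beta> ^ (j * s) * (e (w k) * \<beta> ^ (j * q ^ h * k))"
            by (simp add: beta_power_minus[OF h k])
        qed
        also have "\<dots> = \<beta> ^ (j * s) * dft w (j * q ^ h)"
          by (simp add: dft_def sum_distrib_left)
        also have "\<dots> = 0" using w j by (simp add: bch_code_iff dft_coset)
        finally show ?thesis .
      qed
      then have "u \<in> ?C" by (auto simp: bch_code_iff vecs_def u_def)
      then have "(\<Sum>i<n. u i * w i) = 0" using w by (auto simp: dual_code_def)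
      then show ?thesis by (simp add: u_def mult.commute)
    qed
    fix j
    \<comment> \<open>Expand the square and group the pairs of positions by their sum
      \<open>s\<close> modulo \<open>n\<close>; the coefficient of \<open>\<beta> ^ (j * s)\<close>
      is then the convolution at \<open>s\<close>.\<close>
    have "dft w j * dft w j = (\<Sum>i<n. \<Sum>k<n. e (w i) * e (w k) * \<beta> ^ (j * (i + k)))"
      unfolding dft_def sum_product
      by (intro sum.cong refl) (simp add: algebra_simps power_add)
    also have "\<dots> = (\<Sum>i<n. \<Sum>s<n. e (w i * w (r s i)) * \<beta> ^ (j * s))"
    proof (rule sum.cong[OF refl])
      fix i assume "i \<in> {..<n}"
      then have i: "i < n" by simp
      have r1: "(i + r s i) mod n = s" "r ((s + i) mod n) i = s" if "s < n" for s
      proof -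
        show "(i + r s i) mod n = s" using i that by (simp add: r_def mod_simps)
        show "r ((s + i) mod n) i = s"
          using i that by (cases "s + i < n") (auto simp: r_def mod_if)
      qed
      show "(\<Sum>k<n. e (w i) * e (w k) * \<beta> ^ (j * (i + k)))
          = (\<Sum>s<n. e (w i * w (r s i)) * \<beta> ^ (j * s))"
      proof (rule sum.reindex_bij_witness[of _ "\<lambda>s. r s i" "\<lambda>k. (k + i) mod n"])
        fix k assume "k \<in> {..<n}"
        then have k: "k < n" by simp
        have "[j * ((k + i) mod n) = j * (i + k)] (mod n)"
          by (intro cong_scalar_left) (simp add: cong_def add.commute)
        then have "\<beta> ^ (j * ((k + i) mod n)) = \<beta> ^ (j * (i + k))" by (rule beta_power_cong)
        then show "e (w i * w (r ((k + i) mod n) i)) * \<beta> ^ (j * ((k + i) mod n))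
            = e (w i) * e (w k) * \<beta> ^ (j * (i + k))"
          by (simp add: r1(2)[OF k])
        show "r ((k + i) mod n) i = k" by (rule r1(2)[OF k])
        show "(k + i) mod n \<in> {..<n}" using n_pos by simp
      next
        fix s assume "s \<in> {..<n}"
        then show "(r s i + i) mod n = s" "r s i \<in> {..<n}"
          using r1(1)[of s] r_lt by (auto simp: add.commute)
      qed
    qed
    also have "\<dots> = (\<Sum>s<n. e (\<Sum>i<n. w i * w (r s i)) * \<beta> ^ (j * s))"
      by (subst sum.swap) (simp add: e_sum sum_distrib_right)
    also have "\<dots> = 0" using conv by simp
    finally show "dft w j = 0" by simp
  qed
  moreover have "(\<lambda>_. 0) \<in> ?C" "(\<lambda>_. 0) \<in> dual_code n ?C"
    by (auto simp: bch_code_iff vecs_def dft_def dual_code_def)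
  ultimately show ?thesis unfolding is_LCD_def by blast
qed

text \<open>If the support were too small, the polynomial vanishing at all but one of its locators
  would combine the zero syndromes into the single remaining nonzero term.\<close>

lemma bch_bound:
  assumes v: "v \<in> vecs n" "v \<noteq> (\<lambda>_. 0)" and z: "\<And>i. i + 1 < D \<Longrightarrow> dft v (b + i) = 0"
  shows "D \<le> hweight n v"
proof (rule ccontr)
  assume "\<not> D \<le> hweight n v"
  define S where "S = {i. i < n \<and> v i \<noteq> 0}"
  then have cS: "card S < D" using \<open>\<not> D \<le> hweight n v\<close> by (simp add: hweight_def)
  have fin: "finite S" by (simp add: S_def)
  obtain k where k: "k < n" "v k \<noteq> 0" 
  proof -
    obtain k where "v k \<noteq> 0" using v(2) by auto
    then show thesis using v(1) that[of k] by (cases "k < n") (auto simp: vecs_def)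
  qed
  then have kS: "k \<in> S" by (simp add: S_def)
  \<comment> \<open>Leaving out the factor at \<open>k\<close> gives degree
    \<open>card S - 1\<close>, so only the first \<open>card S\<close> syndromes from
    \<open>b\<close> on occur, and \<open>card S < D\<close> makes them all vanish.\<close>
  define h where "h = (\<Prod>i\<in>S - {k}. [:- (\<beta> ^ i), 1:])"
  have "degree h = card (S - {k})" unfolding h_def by (subst degree_prod_eq_sum_degree) auto
  then have deg: "Suc (degree h) = card S" using fin kS by (simp only: card_Suc_Diff1)
  have "(\<Sum>i<n. e (v i) * \<beta> ^ (b * i) * poly h (\<beta> ^ i))
      = (\<Sum>i<n. \<Sum>s\<le>degree h. coeff h s * (e (v i) * \<beta> ^ ((b + s) * i)))"
    by (intro sum.cong refl)
      (simp add: poly_altdef sum_distrib_left algebra_simps power_add flip: power_mult)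
  also have "\<dots> = (\<Sum>s\<le>degree h. coeff h s * dft v (b + s))"
    by (subst sum.swap) (simp add: dft_def sum_distrib_left)
  also have "\<dots> = 0" using z deg cS by (intro sum.neutral) auto
  finally have "(\<Sum>i<n. e (v i) * \<beta> ^ (b * i) * poly h (\<beta> ^ i)) = 0" .
  moreover have "(\<Sum>i<n. e (v i) * \<beta> ^ (b * i) * poly h (\<beta> ^ i))
      = (\<Sum>i\<in>{k}. e (v i) * \<beta> ^ (b * i) * poly h (\<beta> ^ i))"
  proof (rule sum.mono_neutral_right)
    show "\<forall>i\<in>{..<n} - {k}. e (v i) * \<beta> ^ (b * i) * poly h (\<beta> ^ i) = 0"
    proof
      fix i assume i: "i \<in> {..<n} - {k}"
      show "e (v i) * \<beta> ^ (b * i) * poly h (\<beta> ^ i) = 0"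
      proof (cases "v i = 0")
        case False
        then have "i \<in> S - {k}" using i by (simp add: S_def)
        then have "poly h (\<beta> ^ i) = 0" unfolding h_def poly_prod using fin by (auto intro!: prod_zero bexI[of _ i])
        then show ?thesis by simp
      qed simp
    qed
  qed (use k in auto)
  moreover have "poly h (\<beta> ^ k) \<noteq> 0"
    unfolding h_def poly_prod
    using fin k inj_onD[OF inj_beta, of k] by (auto simp: S_def)
  ultimately show False using k by simp
qed

lemma min_dist_bch_code_1: "min_dist_ge n (bch_code e \<beta> n \<delta> 1) \<delta>"
  unfolding min_dist_ge_def
proof (intro ballI impI)
  fix v assume v: "v \<in> bch_code e \<beta> n \<delta> 1" "v \<noteq> (\<lambda>_. 0)"
  then show "\<delta> \<le> hweight n v" by (intro bch_bound[of v \<delta> 1]) (auto simp: bch_code_iff)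
qed

lemma min_dist_bch_code_0:
  assumes h: "n dvd q ^ h + 1" and "1 \<le> \<delta>"
  shows "min_dist_ge n (bch_code e \<beta> n (\<delta> + 1) 0) (2 * \<delta>)"
  unfolding min_dist_ge_def
proof (intro ballI impI)
  fix v assume v: "v \<in> bch_code e \<beta> n (\<delta> + 1) 0" "v \<noteq> (\<lambda>_. 0)"
  have z: "dft v i = 0" if "i < \<delta>" for i using v that by (auto simp: bch_code_iff)
  \<comment> \<open>A natural number standing for the exponent -(\<delta> - 1) modulo
    \<open>n\<close>; the run of zeros reaches from there to \<delta> - 1.\<close>
  let ?b = "n * \<delta> - (\<delta> - 1)"
  have le: "\<delta> \<le> n * \<delta>" using n_pos by simp
  show "2 * \<delta> \<le> hweight n v"
  proof (rule bch_bound[of v "2 * \<delta>" ?b])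
    fix i assume i: "i + 1 < 2 * \<delta>"
    show "dft v (?b + i) = 0"
    proof (cases "i < \<delta> - 1")
      case False
      then have "?b + i = (i - (\<delta> - 1)) + n * \<delta>" using le assms(2) by linarith
      then have "[?b + i = i - (\<delta> - 1)] (mod n)" by (simp only: cong_def mod_mult_self2)
      then have "dft v (?b + i) = dft v (i - (\<delta> - 1))" by (rule dft_cong)
      then show ?thesis using z i False by simp
    next
      case True
      define j where "j = \<delta> - 1 - i"
      have b: "?b + i + j = n * \<delta>" using True le by (simp only: j_def)
      have "n dvd j * (q ^ h + 1)" using h by (rule dvd_mult)
      then have "n dvd j * q ^ h + j" by (simp add: algebra_simps)
      then have "[?b + i + j = j * q ^ h + j] (mod n)"
        by (simp only: b cong_def dvd_eq_mod_eq_0 mod_mult_self1_is_0)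
      then have "[?b + i = j * q ^ h] (mod n)" by (simp only: cong_add_rcancel_nat)
      then have "dft v (?b + i) = dft v (j * q ^ h)" by (rule dft_cong)
      also have "\<dots> = 0" using z[of j] True by (intro dft_coset) (simp add: j_def)
      finally show ?thesis .
    qed
  qed (use v in \<open>auto simp: bch_code_iff\<close>)
qed

lemma code_dim_bch_code:
  "int (code_dim (bch_code e \<beta> n \<delta> b)) = int n - int (card (cosets {b..b + \<delta> - 2}))"
proof -
  have "card (cosets {b..b + \<delta> - 2}) \<le> n"
    using card_mono[OF _ cosets_subset] by simp
  moreover have "bch_gen e \<beta> \<delta> b \<noteq> 0" using lead_coeff_bch_gen[of \<delta> b] by auto
  ultimately show ?thesis
    using code_dim_cyclic_code[of "bch_gen e \<beta> \<delta> b" n]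
    by (simp add: bch_code_def degree_bch_gen)
qed

end

section \<open>Congruences modulo \<open>q ^ m + 1\<close>\<close>

text \<open>Here \<open>R\<close> is \<open>q\<close>, \<open>P\<close> is \<open>q ^ t\<close>, and \<open>bnd\<close> is \<open>\<lambda>\<close> times the largest admissible
  \<open>\<delta> - 1\<close>, before rounding.\<close>

locale bch_arith =
  fixes R P :: int and t m :: nat
  assumes R3: "3 \<le> R" and P3: "3 * R \<le> P" and Pt: "P = R ^ t" and mt: "m = 2 * t + 1"
begin

text \<open>Written in \<open>R\<close> and \<open>P\<close> so that size estimates become linear in
  \<open>R * P\<close> and \<open>R * P\<^sup>2\<close>.\<close>

definition modulus :: int where "modulus = R * P\<^sup>2 + 1"
definition bnd :: int where "bnd = 2 * (R * P) + 2 * R - 1"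

lemma modulus_eq: "modulus = R ^ m + 1"
proof -
  have "R ^ m = R * (R ^ t)\<^sup>2" by (simp add: mt mult.commute flip: power_mult)
  then show ?thesis unfolding modulus_def by (simp only: Pt)
qed

lemma RP_ge: "3 * P \<le> R * P" "9 \<le> P" "3 * (R * P) \<le> P\<^sup>2" "9 * (R * P) \<le> R * P\<^sup>2"
proof -
  show P9: "9 \<le> P" using R3 P3 by simp
  show "3 * P \<le> R * P" using R3 P9 by (intro mult_right_mono) auto
  show "3 * (R * P) \<le> P\<^sup>2" using mult_right_mono[OF P3, of P] P9 by (simp add: power2_eq_square)
  have "0 \<le> R * P" using R3 P9 by simp
  then show "9 * (R * P) \<le> R * P\<^sup>2"
    using mult_right_mono[OF P9, of "R * P"] by (simp add: power2_eq_square mult_ac)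
qed

text \<open>The second bound is what limits the multiple of \<open>modulus\<close> in
  \<open>small_shift_cases\<close> to 0, 1 or 2.\<close>

lemma bnd_less: "bnd < modulus" "bnd * P + bnd < 3 * modulus"
proof -
  define a b where "a = R * P" and "b = R * P\<^sup>2"
  have ab: "3 * P \<le> a" "9 * a \<le> b" using RP_ge by (simp_all only: a_def b_def)
  then have "2 * a + 2 * R - 1 < b + 1" using R3 P3 by linarith
  then show "bnd < modulus" unfolding bnd_def modulus_def a_def b_def .
  have "bnd * P = 2 * b + 2 * a - P"
    by (simp add: bnd_def a_def b_def algebra_simps power2_eq_square)
  moreover have "bnd = 2 * a + 2 * R - 1" "modulus = b + 1"
    by (simp_all add: bnd_def modulus_def a_def b_def)
  ultimately show "bnd * P + bnd < 3 * modulus" using ab R3 P3 by linarith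
qed

text \<open>If \<open>x = k * (R * P) + u\<close>, then
  \<open>x * P = k * modulus + (u * P - k)\<close>. Thus \<open>y\<close> is, up to sign, the
  residue of \<open>x * R ^ t\<close>.\<close>

definition linked :: "int \<Rightarrow> int \<Rightarrow> bool" where
  "linked x y \<longleftrightarrow> (\<exists>k u. (k = 1 \<or> k = 2) \<and> \<bar>u\<bar> < 2 * R \<and> \<not> R dvd u \<and>
     x = k * (R * P) + u \<and> y = \<bar>k - u * P\<bar>)"

text \<open>By size, the divisible quantity is \<open>modulus * k\<close> with \<open>k\<close> in
  {0, 1, 2}. If \<open>k = 0\<close>, non-divisibility of \<open>y\<close> by \<open>R\<close>
  leaves \<open>s = 0\<close>; otherwise \<open>s = t\<close> is forced, and the bound on
  \<open>y\<close> limits \<open>u\<close>.\<close>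

lemma small_shift_cases:
  assumes x: "0 < x" "x \<le> bnd" "\<not> R dvd x" and y: "0 < y" "y \<le> bnd" "\<not> R dvd y"
    and s: "s \<le> t" and \<sigma>: "\<sigma> = 1 \<or> \<sigma> = -1" and dvd: "modulus dvd x * R ^ s - \<sigma> * y"
  shows "s = 0 \<and> \<sigma> = 1 \<and> x = y \<or> linked x y"
proof -
  obtain k where k: "x * R ^ s - \<sigma> * y = modulus * k" using dvd by (auto simp: dvd_def)
  have Rs: "0 < R ^ s" "R ^ s \<le> P"
    using R3 s by (auto simp: Pt intro!: power_increasing)
  have xR: "0 < x * R ^ s" "x * R ^ s \<le> bnd * P"
    using x Rs by (auto intro!: mult_mono)
  have sy: "- bnd \<le> \<sigma> * y" "\<sigma> * y \<le> bnd" "\<bar>\<sigma> * y\<bar> = y" using y \<sigma> by auto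
  have mod_pos: "0 < modulus" "bnd < modulus" using bnd_less(1) y by linarith+
  have "modulus * k < modulus * 3" "modulus * (-1) < modulus * k"
    using k sy xR mod_pos bnd_less(2) by linarith+
  then have k3: "k < 3" "-1 < k" using mod_pos by (simp_all only: mult_less_cancel_left_pos)
  show ?thesis
  proof (cases "k = 0")
    case True
    then have e: "x * R ^ s = \<sigma> * y" using k by simp
    then have "\<sigma> = 1" using \<sigma> xR y by auto
    moreover have "s = 0"
    proof (rule ccontr)
      assume "s \<noteq> 0"
      then have "R dvd x * R ^ s" by (simp add: dvd_power)
      with e \<open>\<sigma> = 1\<close> y show False by simp
    qed
    ultimately show ?thesis using e by simp
  next
    case False
    then have k1: "k = 1 \<or> k = 2" using k3 by auto
    have mk: "modulus \<le> modulus * k" using k1 mod_pos by auto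
    \<comment> \<open>For \<open>s < t\<close>, even \<open>x * R ^ Suc s\<close> is at most
      \<open>bnd * P\<close>, roughly \<open>2 * (R * P\<^sup>2)\<close>, whereas
      \<open>modulus * R\<close> exceeds \<open>3 * (R * P\<^sup>2)\<close>.\<close>
    have "s = t"
    proof (rule ccontr)
      assume "s \<noteq> t"
      then have "R ^ Suc s \<le> P" unfolding Pt using R3 s by (intro power_increasing) auto
      then have "x * R ^ Suc s \<le> bnd * P" using x R3 by (intro mult_mono) auto
      moreover have "modulus * R \<le> (x * R ^ s + bnd) * R"
        using mk k sy R3 by (intro mult_right_mono) auto
      ultimately have "modulus * R \<le> bnd * P + bnd * R" by (simp add: algebra_simps)
      moreover have "bnd * P = 2 * (R * P\<^sup>2) + 2 * (R * P) - P"
        by (simp add: bnd_def algebra_simps power2_eq_square)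
      moreover have "bnd * R = 2 * (R * (R * P)) + 2 * (R * R) - R"
        by (simp add: bnd_def algebra_simps)
      moreover have "modulus * R = R * (R * P\<^sup>2) + R" by (simp add: modulus_def algebra_simps)
      moreover have "3 * (R * P\<^sup>2) \<le> R * (R * P\<^sup>2)" using R3 by (intro mult_right_mono) auto
      moreover have "R * (3 * (R * P)) \<le> R * P\<^sup>2" using RP_ge R3 by (intro mult_left_mono) auto
      moreover have "R * (3 * P) \<le> R * (R * P)" using RP_ge R3 by (intro mult_left_mono) auto
      moreover have "R * (3 * R) \<le> R * P" using P3 R3 by (intro mult_left_mono) auto
      moreover have "R * (3 * (R * P)) = 3 * (R * (R * P))" "R * (3 * P) = 3 * (R * P)"
        "R * (3 * R) = 3 * (R * R)" by simp_all
      ultimately show False using R3 P3 RP_ge by linarith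
    qed
    define u where "u = x - k * (R * P)"
    have e: "\<sigma> * y = u * P - k"
      using k unfolding \<open>s = t\<close> Pt[symmetric] modulus_def u_def
      by (simp add: algebra_simps power2_eq_square)
    then have y_eq: "y = \<bar>k - u * P\<bar>" using sy(3) by linarith
    have xu: "x = k * (R * P) + u" by (simp add: u_def)
    have Ru: "\<not> R dvd u"
    proof
      assume "R dvd u"
      then have "R dvd k * (R * P) + u" by simp
      with xu x show False by simp
    qed
    \<comment> \<open>The bound on \<open>y\<close> gives only that the absolute value of
      \<open>u\<close> is at most \<open>2 * R\<close>; the extreme value is a multiple of
      \<open>R\<close> and drops out.\<close>
    have "\<bar>u\<bar> * P = \<bar>u * P\<bar>" using RP_ge by (simp add: abs_mult)
    also have "\<dots> \<le> bnd + 2" using y_eq y k1 by linarith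
    also have "\<dots> < (2 * R + 1) * P" using P3 R3 by (simp add: bnd_def algebra_simps)
    finally have "\<bar>u\<bar> < 2 * R + 1" using RP_ge by (auto simp only: mult_less_cancel_right)
    moreover have "\<bar>u\<bar> \<noteq> 2 * R" using Ru by (metis dvd_abs_iff dvd_triv_right)
    ultimately have "\<bar>u\<bar> < 2 * R" by simp
    with k1 Ru xu y_eq show ?thesis unfolding linked_def by blast
  qed
qed

text \<open>As \<open>R ^ m\<close> is -1, every exponent reduces to one in 0..t: between
  \<open>t\<close> and \<open>m\<close> by exchanging \<open>x\<close> with \<open>y\<close> and
  changing sign, from \<open>m\<close> to \<open>m + t\<close> by a sign change alone, beyond that
  by an exchange alone. Here \<open>m = 2 * t + 1\<close> makes the four ranges fit.\<close>

lemma shift_cases: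
  assumes x: "0 < x" "x \<le> bnd" "\<not> R dvd x" and y: "0 < y" "y \<le> bnd" "\<not> R dvd y"
    and r: "r < 2 * m" and dvd: "modulus dvd x * R ^ r - y"
  shows "r = 0 \<and> x = y \<or> linked x y \<or> linked y x"
proof -
  consider "r \<le> t" | "t < r" "r < m" | "m \<le> r" "r \<le> m + t" | "m + t < r" by linarith
  then show ?thesis
  proof cases
    case 1
    then show ?thesis using small_shift_cases[OF x y, of r 1] dvd by auto
  next
    case 2
    have p: "R ^ (m - r) * R ^ r = R ^ m" using 2 by (simp flip: power_add)
    have "y * R ^ (m - r) - (-1) * x = x * modulus - R ^ (m - r) * (x * R ^ r - y)"
      by (simp add: modulus_eq algebra_simps p[symmetric])
    then have "modulus dvd y * R ^ (m - r) - (-1) * x"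
      using dvd by (simp only: dvd_diff dvd_mult dvd_triv_right)
    then show ?thesis using small_shift_cases[OF y x, of "m - r" "-1"] 2 mt by auto
  next
    case 3
    have p: "R ^ (r - m) * R ^ m = R ^ r" using 3 by (simp flip: power_add)
    have "x * R ^ (r - m) - (-1) * y = x * R ^ (r - m) * modulus - (x * R ^ r - y)"
      by (simp add: modulus_eq algebra_simps p[symmetric])
    then have "modulus dvd x * R ^ (r - m) - (-1) * y"
      using dvd by (simp only: dvd_diff dvd_triv_right)
    then show ?thesis using small_shift_cases[OF x y, of "r - m" "-1"] 3 by auto
  next
    case 4
    have p: "R ^ (2 * m - r) * R ^ r = R ^ m * R ^ m" using r by (simp add: mult_2 flip: power_add)
    have "y * R ^ (2 * m - r) - 1 * x
        = x * (R ^ m - 1) * modulus - R ^ (2 * m - r) * (x * R ^ r - y)"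
      using p by (simp add: modulus_eq algebra_simps)
    then have "modulus dvd y * R ^ (2 * m - r) - 1 * x"
      using dvd by (simp only: dvd_diff dvd_mult dvd_triv_right)
    then show ?thesis using small_shift_cases[OF y x, of "2 * m - r" 1] 4 r mt by auto
  qed
qed

text \<open>Up to \<open>bnd\<close> and apart from multiples of \<open>R\<close>, these are the
  larger members of linked pairs. The window comes from \<open>k = 1\<close> with small
  \<open>u\<close>, the top range from \<open>k = 2\<close>, and the two progressions from
  \<open>k = 1\<close> with \<open>u\<close> beyond \<open>R\<close> in absolute value.\<close>

definition dup :: "int \<Rightarrow> bool" where
  "dup x \<longleftrightarrow> (\<exists>u. \<bar>u\<bar> < R \<and> x = R * P + u) \<or> 2 * (R * P) - 2 * R < x \<or>
     (\<exists>u. 1 \<le> u \<and> u < R \<and> (x = R * P + u * P + 1 \<or> x = R * P + u * P - 1))"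

text \<open>Compare \<open>x\<close>, about \<open>k * (R * P)\<close>, with \<open>y\<close>, about
  \<open>P\<close> times the absolute value of \<open>u\<close>: \<open>y\<close> is the larger one
  only when \<open>k = 1\<close> and \<open>u\<close> exceeds \<open>R\<close> in absolute
  value.\<close>

lemma linked_dup:
  assumes "linked x y"
  shows "y < x \<and> dup x \<or> x < y \<and> dup y"
proof -
  obtain k u where k: "k = 1 \<or> k = 2" and u: "\<bar>u\<bar> < 2 * R" "\<not> R dvd u"
    and xy: "x = k * (R * P) + u" "y = \<bar>k - u * P\<bar>"
    using assms unfolding linked_def by blast
  have u0: "u \<noteq> 0" "u \<noteq> R" "u \<noteq> - R" using u by auto
  have upos: "P \<le> u * P" if "0 < u" using that mult_right_mono[of 1 u P] RP_ge by simp
  have uneg: "u * P \<le> - P" if "u < 0" using that mult_right_mono[of u "-1" P] RP_ge by simp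
  have y_eq: "y = (if 0 < u then u * P - k else k - u * P)"
  proof (cases "0 < u")
    case True
    then have "k < u * P" using upos RP_ge(2) k by linarith
    then show ?thesis using True xy(2) by simp
  next
    case False
    then have "u < 0" using u0 by simp
    then have "u * P < k" using uneg RP_ge(2) k by linarith
    then show ?thesis using False xy(2) by simp
  qed
  consider "k = 2" | "k = 1" "\<bar>u\<bar> < R" | "k = 1" "R < u" | "k = 1" "u < - R"
    using k u0 by linarith
  then show ?thesis
  proof cases
    case 1
    have "\<bar>u\<bar> * P \<le> (2 * R - 1) * P" using u RP_ge by (intro mult_right_mono) auto
    then have "y \<le> 2 * (R * P) - P + 2" using y_eq 1 by (auto simp: algebra_simps split: if_splits)
    moreover have "2 * (R * P) - 2 * R < x" using 1 xy u by auto
    ultimately show ?thesis using P3 R3 by (auto simp: dup_def)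
  next
    case 2
    have "\<bar>u\<bar> * P \<le> (R - 1) * P" using 2 RP_ge by (intro mult_right_mono) auto
    then have "y \<le> R * P - P + 1" using y_eq 2 by (auto simp: algebra_simps split: if_splits)
    moreover have "R * P - R < x" using 2 xy by auto
    moreover have "dup x" using 2 xy by (auto simp: dup_def)
    ultimately show ?thesis using P3 R3 by auto
  next
    case 3
    define w where "w = u - R"
    have w: "1 \<le> w" "w < R" using 3 u by (auto simp: w_def)
    have y: "y = R * P + w * P - 1" using y_eq 3 R3 by (simp add: w_def algebra_simps)
    have "P \<le> w * P" using w mult_right_mono[of 1 w P] RP_ge by simp
    moreover have "x < R * P + 2 * R" using xy(1) u 3 by auto
    ultimately have "x < y" unfolding y using P3 R3 by linarith
    moreover have "dup y" using w y by (auto simp: dup_def)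
    ultimately show ?thesis by simp
  next
    case 4
    define w where "w = - u - R"
    have w: "1 \<le> w" "w < R" using 4 u by (auto simp: w_def)
    have y: "y = R * P + w * P + 1" using y_eq 4 R3 by (simp add: w_def algebra_simps)
    have "P \<le> w * P" using w mult_right_mono[of 1 w P] RP_ge by simp
    moreover have "x < R * P + 2 * R" using xy(1) u 4 by auto
    ultimately have "x < y" unfolding y using P3 R3 by linarith
    moreover have "dup y" using w y by (auto simp: dup_def)
    ultimately show ?thesis by simp
  qed
qed

section \<open>Orbits under multiplication by powers of \<open>R\<close>\<close>

definition related :: "int \<Rightarrow> int \<Rightarrow> bool" where
  "related x y \<longleftrightarrow> (\<exists>r. modulus dvd x * R ^ r - y)"

lemma related_uminus: "related x y \<Longrightarrow> related x (- y)"
proof -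
  assume "related x y"
  then obtain r where r: "modulus dvd x * R ^ r - y" by (auto simp: related_def)
  have "x * R ^ (r + m) - (- y) = x * R ^ r * modulus - (x * R ^ r - y)"
    by (simp add: modulus_eq algebra_simps power_add)
  then have "modulus dvd x * R ^ (r + m) - (- y)"
    using r by (simp only: dvd_diff dvd_triv_right)
  then show ?thesis unfolding related_def by blast
qed

lemma modulus_dvd_power_2m: "modulus dvd R ^ (2 * m * k) - 1"
proof -
  have "modulus dvd (R ^ (2 * m)) ^ k - 1 ^ k"
  proof (rule dvd_trans)
    have "R ^ (2 * m) - 1 = (R ^ m - 1) * modulus"
      unfolding modulus_eq mult_2 power_add by (simp add: algebra_simps)
    then show "modulus dvd R ^ (2 * m) - 1" by simp
    show "R ^ (2 * m) - 1 dvd (R ^ (2 * m)) ^ k - 1 ^ k"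
      by (metis dvd_def power_diff_sumr2)
  qed
  then show ?thesis by (simp add: power_mult)
qed

lemma related_sym: "related x y \<Longrightarrow> related y x"
proof -
  assume "related x y"
  then obtain r where r: "modulus dvd x * R ^ r - y" by (auto simp: related_def)
  \<comment> \<open>The exponent \<open>2 * m * r\<close> is a multiple of the period
    \<open>2 * m\<close> that is at least \<open>r\<close>, so subtracting \<open>r\<close> gives an
    inverse shift without reducing \<open>r\<close>.\<close>
  have p: "R ^ (2 * m * r - r) * R ^ r = R ^ (2 * m * r)"
    using mt by (simp flip: power_add)
  have "y * R ^ (2 * m * r - r) - x
      = x * (R ^ (2 * m * r) - 1) - R ^ (2 * m * r - r) * (x * R ^ r - y)"
    unfolding p[symmetric] by (simp only: algebra_simps)
  then have "modulus dvd y * R ^ (2 * m * r - r) - x"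
    using r modulus_dvd_power_2m by (simp only: dvd_diff dvd_mult)
  then show ?thesis unfolding related_def by blast
qed

text \<open>Converse to the case analysis: exponent \<open>t\<close> produces
  \<open>u * P - k\<close>, and the sign is free by \<open>related_uminus\<close>.\<close>

lemma related_linked:
  assumes "x = k * (R * P) + u" 
  shows "related x \<bar>k - u * P\<bar>"
proof -
  have "x * R ^ t - (u * P - k) = k * modulus"
    unfolding modulus_def Pt[symmetric] assms by (simp add: algebra_simps power2_eq_square)
  then have 1: "related x (u * P - k)" unfolding related_def by (metis dvd_triv_right)
  show ?thesis
    using related_uminus[OF 1] 1 by (cases "0 \<le> k - u * P") auto
qed

text \<open>In the window and the top range the partner of \<open>x\<close> under exponent
  \<open>t\<close> is smaller. On the progressions \<open>x\<close> is itself the partner of a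
  smaller \<open>z\<close>, close to \<open>R * P\<close>, and symmetry reverses the
  relation.\<close>

lemma dup_related:
  assumes "dup x" "x \<le> bnd" "\<not> R dvd x"
  shows "\<exists>y. 0 < y \<and> y < x \<and> related x y"
proof -
  consider (1) u where "\<bar>u\<bar> < R" "x = R * P + u" | (2) "2 * (R * P) - 2 * R < x" 
    | (3) u where "1 \<le> u" "u < R" "x = R * P + u * P + 1"
    | (4) u where "1 \<le> u" "u < R" "x = R * P + u * P - 1"
    using assms(1) unfolding dup_def by blast
  then show ?thesis
  proof cases
    case 1
    then have u0: "u \<noteq> 0" using assms(3) by auto
    have "\<bar>u\<bar> * P \<le> (R - 1) * P" using 1 RP_ge by (intro mult_right_mono) auto
    moreover have "1 * P \<le> \<bar>u\<bar> * P" using u0 RP_ge by (intro mult_right_mono) auto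
    moreover have "\<bar>u\<bar> * P = \<bar>u * P\<bar>" using RP_ge by (simp add: abs_mult)
    moreover have "(R - 1) * P = R * P - P" by (simp add: algebra_simps)
    ultimately have "0 < \<bar>1 - u * P\<bar>" "\<bar>1 - u * P\<bar> < x"
      using 1 R3 P3 by linarith+
    then show ?thesis using related_linked[of x 1 u] 1(2) unfolding mult_1 by blast
  next
    case 2
    define u where "u = x - 2 * (R * P)"
    have u: "\<bar>u\<bar> < 2 * R" using 2 assms(2) by (auto simp: u_def bnd_def)
    have u0: "u \<noteq> 0" using assms(3) by (auto simp: u_def)
    have x: "x = 2 * (R * P) + u" by (simp add: u_def)
    have "\<bar>u\<bar> * P \<le> (2 * R - 1) * P" using u RP_ge by (intro mult_right_mono) auto
    moreover have "1 * P \<le> \<bar>u\<bar> * P" using u0 RP_ge by (intro mult_right_mono) auto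
    moreover have "\<bar>u\<bar> * P = \<bar>u * P\<bar>" using RP_ge by (simp add: abs_mult)
    moreover have "(2 * R - 1) * P = 2 * (R * P) - P" by (simp add: algebra_simps)
    ultimately have "0 < \<bar>2 - u * P\<bar>" "\<bar>2 - u * P\<bar> < x"
      using u x R3 P3 by linarith+
    then show ?thesis using related_linked[OF x] by blast
  next
    case 3
    define z where "z = R * P - (R + u)"
    have "1 * P \<le> u * P" using 3 RP_ge by (intro mult_right_mono) auto
    then have "0 < z" "z < x" using 3 R3 P3 RP_ge unfolding z_def by linarith+
    moreover have "related z \<bar>1 - (- (R + u)) * P\<bar>"
      by (rule related_linked) (simp add: z_def)
    moreover have "\<bar>1 - (- (R + u)) * P\<bar> = x"
      using \<open>0 < z\<close> \<open>z < x\<close> by (simp add: 3 algebra_simps)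
    ultimately show ?thesis using related_sym by metis
  next
    case 4
    define z where "z = R * P + (R + u)"
    have "1 * P \<le> u * P" using 4 RP_ge by (intro mult_right_mono) auto
    then have "0 < z" "z < x" using 4 R3 P3 RP_ge unfolding z_def by linarith+
    moreover have "related z \<bar>1 - (R + u) * P\<bar>"
      by (rule related_linked) (simp add: z_def)
    moreover have "\<bar>1 - (R + u) * P\<bar> = x"
      using \<open>0 < z\<close> \<open>z < x\<close> by (simp add: 4 algebra_simps)
    ultimately show ?thesis using related_sym by metis
  qed
qed

end

section \<open>Coset leaders\<close>

locale bch_params =
  fixes q lam m t n :: nat
  assumes q3: "3 \<le> q" and lam2: "2 \<le> lam" and lam_dvd: "lam dvd q + 1" and lam_less: "lam < q + 1"
    and m_eq: "m = 2 * t + 1" and t2: "2 \<le> t" and even_t: "even t" and n_lam: "n * lam = q ^ m + 1"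

sublocale bch_params \<subseteq> bch_arith "int q" "int q ^ t" t m
proof
  show "3 \<le> int q" using q3 by simp
  have "3 * q \<le> q ^ 2" using q3 by (simp add: power2_eq_square)
  also have "\<dots> \<le> q ^ t" using q3 t2 by (intro power_increasing) auto
  finally have "int (3 * q) \<le> int (q ^ t)" by (simp only: of_nat_le_iff)
  then show "3 * int q \<le> int q ^ t" by simp
qed (use m_eq in auto)

section \<open>From indices modulo \<open>n\<close> to multiples of \<open>lam\<close> modulo
  \<open>modulus\<close>\<close>

context bch_params
begin

lemma n_pos: "0 < n" using n_lam by (metis add_is_0 mult_is_0 neq0_conv one_neq_zero)

lemma modulus_n: "modulus = int lam * int n"
proof -
  have "int (n * lam) = int (q ^ m + 1)" by (simp only: n_lam)
  then show ?thesis by (simp add: modulus_eq mult.commute)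
qed

lemma coprime_q_n: "coprime q n"
proof -
  have "coprime q (q ^ m + 1)"
  proof (rule coprimeI)
    fix c assume "c dvd q" "c dvd q ^ m + 1"
    moreover have "c dvd q ^ m" using \<open>c dvd q\<close> m_eq by (simp add: dvd_trans[OF _ dvd_power])
    ultimately show "is_unit c" using dvd_add_right_iff[of c "q ^ m" 1] by blast
  qed
  then show ?thesis unfolding n_lam[symmetric] by simp
qed

lemma coprime_q_lam: "coprime q lam"
proof -
  have "coprime q (q + 1)" by simp
  then show ?thesis using lam_dvd coprime_divisors[of q q lam "q + 1"] by simp
qed

lemma modulus_dvd_iff:
  "modulus dvd int (lam * i) * int q ^ r - int (lam * j) \<longleftrightarrow> [i * q ^ r = j] (mod n)"
proof -
  have "int (lam * i) * int q ^ r - int (lam * j) = int lam * (int (i * q ^ r) - int j)"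
    by (simp add: algebra_simps)
  then have "modulus dvd int (lam * i) * int q ^ r - int (lam * j)
      \<longleftrightarrow> int n dvd int (i * q ^ r) - int j"
    using lam2 by (simp only: modulus_n dvd_mult_cancel_left) auto
  also have "\<dots> \<longleftrightarrow> [i * q ^ r = j] (mod n)"
    by (simp only: cong_int_iff[symmetric] cong_iff_dvd_diff)
  finally show ?thesis .
qed

lemma power_2m_cong: "[q ^ (2 * m * k) = 1] (mod n)"
proof -
  have "int n dvd int q ^ (2 * m * k) - 1"
    using modulus_dvd_power_2m[of k] modulus_n by (metis dvd_mult_right)
  then have "[int (q ^ (2 * m * k)) = int 1] (mod int n)" by (simp add: cong_iff_dvd_diff)
  then show ?thesis by (simp only: cong_int_iff)
qed

lemma cong_power_mod: "[i * q ^ r = i * q ^ (r mod (2 * m))] (mod n)"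
proof -
  have "q ^ r = q ^ (2 * m * (r div (2 * m))) * q ^ (r mod (2 * m))"
    by (simp flip: power_add)
  then have "[q ^ r = 1 * q ^ (r mod (2 * m))] (mod n)"
    using cong_mult[OF power_2m_cong cong_refl] by metis
  then show ?thesis by (simp add: cong_scalar_left)
qed

lemma cong_shift_back:
  assumes "[i * q ^ r = j] (mod n)"
  shows "[j * q ^ (2 * m * r - r) = i] (mod n)"
proof -
  have "q ^ r * q ^ (2 * m * r - r) = q ^ (2 * m * r)" using m_eq by (simp flip: power_add)
  then have "i * q ^ r * q ^ (2 * m * r - r) = i * q ^ (2 * m * r)" by (simp only: mult.assoc)
  moreover have "[i * q ^ (2 * m * r) = i * 1] (mod n)"
    by (intro cong_scalar_left power_2m_cong)
  moreover have "[i * q ^ r * q ^ (2 * m * r - r) = j * q ^ (2 * m * r - r)] (mod n)"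
    by (intro cong_scalar_right assms)
  ultimately show ?thesis by (metis cong_sym cong_trans mult_1_right)
qed

text \<open>Minimality is over all positive representatives, not only those below \<open>n\<close>;
  so the coset of 0 is led by \<open>n\<close>, which lies outside the range of the counts.\<close>

definition leader :: "nat \<Rightarrow> bool" where
  "leader i \<longleftrightarrow> 1 \<le> i \<and> (\<forall>j r. 1 \<le> j \<and> [i * q ^ r = j] (mod n) \<longrightarrow> i \<le> j)"

lemma leader_exists:
  assumes "1 \<le> i"
  obtains l r where "leader l" "l \<le> i" "[i * q ^ r = l] (mod n)"
proof -
  let ?Q = "\<lambda>j. 1 \<le> j \<and> (\<exists>r. [i * q ^ r = j] (mod n))"
  define l where "l = (LEAST j. ?Q j)"
  have Qi: "?Q i" using assms by (auto intro!: exI[of _ 0])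
  then have "?Q l" unfolding l_def by (rule LeastI)
  then obtain r where r: "1 \<le> l" "[i * q ^ r = l] (mod n)" by blast
  have "l \<le> i" unfolding l_def using Qi by (rule Least_le)
  moreover have "leader l"
    unfolding leader_def
  proof (intro conjI allI impI)
    fix j s assume js: "1 \<le> j \<and> [l * q ^ s = j] (mod n)"
    have "[i * q ^ r * q ^ s = l * q ^ s] (mod n)" by (intro cong_scalar_right r)
    then have "[i * q ^ (r + s) = j] (mod n)"
      using js by (metis cong_trans mult.assoc power_add)
    then have "?Q j" using js by blast
    then show "l \<le> j" unfolding l_def by (rule Least_le)
  qed (use r in simp)
  ultimately show thesis using r that by blast
qed

lemma q_dvd_lam_mult: "int q dvd int (lam * i) \<longleftrightarrow> q dvd i"
  using coprime_q_lam by (simp only: int_dvd_int_iff) (simp add: coprime_dvd_mult_right_iff)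

text \<open>If \<open>q\<close> divides \<open>i\<close>, then \<open>i / q\<close> is a smaller
  member of the same coset.\<close>

lemma leader_not_dvd:
  assumes "leader i"
  shows "\<not> q dvd i"
proof
  assume "q dvd i"
  then obtain j where j: "i = q * j" by (auto simp: dvd_def)
  then have j1: "1 \<le> j" "j < i" using assms q3 by (auto simp: leader_def)
  have "[j * q ^ 1 = i] (mod n)" by (simp add: j mult.commute)
  from cong_shift_back[OF this] show False using assms j1 unfolding leader_def by fastforce
qed

text \<open>A duplicate has a smaller related number. Conversely, the leader of the coset of
  \<open>i\<close> is at most \<open>i\<close>, and after scaling by \<open>lam\<close> it is equal
  or linked to \<open>i\<close>; a link would make \<open>lam * i\<close> a duplicate.\<close>

lemma leader_iff:
  assumes i: "1 \<le> i" "int (lam * i) \<le> bnd"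
  shows "leader i \<longleftrightarrow> \<not> q dvd i \<and> \<not> dup (int (lam * i))"
proof
  assume l: "leader i"
  have q: "\<not> q dvd i" by (rule leader_not_dvd[OF l])
  moreover have "\<not> dup (int (lam * i))"
  proof
    assume "dup (int (lam * i))"
    then obtain y where y: "0 < y" "y < int (lam * i)" "related (int (lam * i)) y"
      using dup_related[of "int (lam * i)"] i q q_dvd_lam_mult by blast
    then obtain r where r: "modulus dvd int (lam * i) * int q ^ r - y"
      by (auto simp: related_def)
    \<comment> \<open>Since \<open>lam\<close> divides \<open>modulus\<close> and
      \<open>lam * i\<close>, it divides \<open>y\<close> too, so the smaller number is again
      \<open>lam\<close> times an index.\<close>
    have "int lam dvd int (lam * i) * int q ^ r - y"
      by (rule dvd_trans[OF _ r]) (simp add: modulus_n)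
    moreover have "int lam dvd int (lam * i) * int q ^ r" by simp
    ultimately have "int lam dvd y" using dvd_diff_right_iff by blast
    then obtain z where z: "y = int lam * z" by (auto simp: dvd_def)
    then have "0 < z" using y lam2 by (simp add: zero_less_mult_iff)
    define j where "j = nat z"
    have yj: "y = int (lam * j)" using z \<open>0 < z\<close> by (simp add: j_def)
    have "1 \<le> j" using \<open>0 < z\<close> by (simp add: j_def)
    moreover have "j < i" using y(2) lam2 unfolding yj by simp
    moreover have "[i * q ^ r = j] (mod n)" using r unfolding yj modulus_dvd_iff .
    ultimately show False using l unfolding leader_def by fastforce
  qed
  ultimately show "\<not> q dvd i \<and> \<not> dup (int (lam * i))" by simp
next
  assume nd: "\<not> q dvd i \<and> \<not> dup (int (lam * i))"
  obtain l r where l: "leader l" "l \<le> i" "[i * q ^ r = l] (mod n)" using leader_exists[OF i(1)] .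
  have l1: "1 \<le> l" "\<not> q dvd l" using l leader_not_dvd by (auto simp: leader_def)
  have "[i * q ^ (r mod (2 * m)) = l] (mod n)"
    using l(3) cong_power_mod cong_sym cong_trans by blast
  then have d: "modulus dvd int (lam * i) * int q ^ (r mod (2 * m)) - int (lam * l)"
    by (simp only: modulus_dvd_iff)
  have le: "int (lam * l) \<le> int (lam * i)" using l(2) by (simp only: of_nat_le_iff mult_le_mono2)
  have pos: "0 < int (lam * i)" "0 < int (lam * l)" using i(1) l1 lam2 by auto
  have r: "r mod (2 * m) < 2 * m" using m_eq by simp
  have bl: "int (lam * l) \<le> bnd" using le i(2) by (rule order_trans)
  have qi: "\<not> int q dvd int (lam * i)" "\<not> int q dvd int (lam * l)"
    using nd l1 q_dvd_lam_mult by blast+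
  have "int (lam * i) = int (lam * l) \<or> linked (int (lam * i)) (int (lam * l))
      \<or> linked (int (lam * l)) (int (lam * i))"
    using shift_cases[OF pos(1) i(2) qi(1) pos(2) bl qi(2) r d] by blast
  then have "int (lam * i) = int (lam * l)"
    using linked_dup[of "int (lam * i)" "int (lam * l)"] linked_dup[of "int (lam * l)" "int (lam * i)"]
      le nd leD by blast
  then have "i = l" using lam2 by simp
  with l show "leader i" by simp
qed

text \<open>This makes the coset of a leader have full size \<open>2 * m\<close>: linked numbers are
  distinct, so none is linked to itself.\<close>

lemma leader_power_inj:
  assumes l: "leader i" "int (lam * i) \<le> bnd" and r: "r < 2 * m" "[i * q ^ r = i] (mod n)"
  shows "r = 0"
proof -
  have qi: "\<not> int q dvd int (lam * i)" using leader_not_dvd[OF l(1)] q_dvd_lam_mult by blast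
  have pos: "0 < int (lam * i)" using l lam2 by (auto simp: leader_def)
  have "modulus dvd int (lam * i) * int q ^ r - int (lam * i)" using r by (simp only: modulus_dvd_iff)
  from shift_cases[OF pos l(2) qi pos l(2) qi r(1) this]
  show ?thesis using linked_dup[of "int (lam * i)" "int (lam * i)"] by blast
qed

text \<open>Pairs of a leader and an exponent below \<open>2 * m\<close> parametrise the union
  bijectively; the leader of the coset of any \<open>i \<le> D\<close> is again at most
  \<open>D\<close>.\<close>

lemma card_q_cosets:
  assumes D: "int (lam * D) \<le> bnd"
  shows "card (q_cosets q n {1..D}) = 2 * m * card {i \<in> {1..D}. leader i}"
proof -
  let ?L = "{i \<in> {1..D}. leader i}"
  let ?f = "\<lambda>(i, s). (i * q ^ s) mod n"
  have bi: "int (lam * i) \<le> bnd" if "i \<le> D" for i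
  proof -
    have "lam * i \<le> lam * D" using that by simp
    then have "int (lam * i) \<le> int (lam * D)" by (simp only: of_nat_le_iff)
    then show ?thesis using D by simp
  qed
  have same: "s = s'" if "leader i" "i \<le> D" "s \<le> s'" "s' < 2 * m"
      "[i * q ^ s = i * q ^ s'] (mod n)" for i s s'
  proof -
    have "q ^ s' = q ^ (s' - s) * q ^ s" using that by (simp flip: power_add)
    then have "[i * q ^ (s' - s) * q ^ s = i * q ^ s] (mod n)"
      using that(5) by (simp only: mult.assoc cong_sym_eq)
    then have "[i * q ^ (s' - s) = i] (mod n)"
      using coprime_q_n by (subst (asm) cong_mult_rcancel_nat) auto
    then have "s' - s = 0" using that bi by (intro leader_power_inj[of i]) auto
    then show ?thesis using that by simp
  qed
  have "inj_on ?f (?L \<times> {..<2 * m})"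
  proof (rule inj_onI, clarify)
    fix i s i' s'
    assume i: "i \<in> {1..D}" "leader i" "i' \<in> {1..D}" "leader i'" and s: "s < 2 * m" "s' < 2 * m"
      and eq: "i * q ^ s mod n = i' * q ^ s' mod n"
    \<comment> \<open>Undoing the shift by \<open>y\<close> puts \<open>b\<close> into the coset of
      \<open>a\<close>, where \<open>a\<close> is minimal; with the roles exchanged, both leaders
      agree.\<close>
    have le: "a \<le> b" if "leader a" "leader b" "[a * q ^ x = b * q ^ y] (mod n)" for a b x y
    proof -
      have "[b * q ^ y * q ^ (2 * m * y - y) = b] (mod n)"
      proof -
        have "q ^ y * q ^ (2 * m * y - y) = q ^ (2 * m * y)" using m_eq by (simp flip: power_add)
        then show ?thesis
          using cong_scalar_left[OF power_2m_cong[of y], of b] by (simp add: mult.assoc)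
      qed
      moreover have "[a * q ^ x * q ^ (2 * m * y - y) = b * q ^ y * q ^ (2 * m * y - y)] (mod n)"
        by (intro cong_scalar_right that)
      ultimately have "[a * q ^ (x + (2 * m * y - y)) = b] (mod n)"
        by (metis cong_trans mult.assoc power_add)
      then show ?thesis using that(1,2) unfolding leader_def by blast
    qed
    have c: "[i * q ^ s = i' * q ^ s'] (mod n)" using eq by (simp add: cong_def)
    then have ii: "i = i'" using le i cong_sym[OF c] by (intro antisym) blast+
    have "s = s'"
    proof (cases "s \<le> s'")
      case True
      then show ?thesis using same[of i s s'] c ii i s by auto
    next
      case False
      then show ?thesis using same[of i s' s] cong_sym[OF c] ii i s by auto
    qed
    with ii show "i = i' \<and> s = s'" by simp
  qed
  moreover have "?f ` (?L \<times> {..<2 * m}) = q_cosets q n {1..D}"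
  proof (intro equalityI subsetI)
    fix x assume "x \<in> ?f ` (?L \<times> {..<2 * m})"
    then show "x \<in> q_cosets q n {1..D}" unfolding q_cosets_def by auto
  next
    fix x assume "x \<in> q_cosets q n {1..D}"
    then obtain i s where x: "i \<in> {1..D}" "x = (i * q ^ s) mod n" unfolding q_cosets_def by blast
    then have "1 \<le> i" by simp
    then obtain l r where l: "leader l" "l \<le> i" "[i * q ^ r = l] (mod n)" by (rule leader_exists)
    define r' where "r' = 2 * m * r - r"
    have "[l * q ^ r' = i] (mod n)" using cong_shift_back[OF l(3)] by (simp add: r'_def)
    then have "[l * q ^ r' * q ^ s = i * q ^ s] (mod n)" by (rule cong_scalar_right)
    then have "[i * q ^ s = l * q ^ (r' + s)] (mod n)"
      by (simp add: power_add mult.assoc cong_sym_eq)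
    then have "[i * q ^ s = l * q ^ ((r' + s) mod (2 * m))] (mod n)"
      using cong_power_mod cong_trans by blast
    then have "x = ?f (l, (r' + s) mod (2 * m))" using x by (simp add: cong_def)
    moreover have "(l, (r' + s) mod (2 * m)) \<in> ?L \<times> {..<2 * m}"
      using l x m_eq by (auto simp: leader_def)
    ultimately show "x \<in> ?f ` (?L \<times> {..<2 * m})" by (rule image_eqI)
  qed
  ultimately have "card (q_cosets q n {1..D}) = card (?L \<times> {..<2 * m})"
    using card_image[of ?f "?L \<times> {..<2 * m}"] by (simp only:)
  then show ?thesis by (simp add: card_cartesian_product)
qed

text \<open>Together with \<open>zero_notin_q_cosets\<close>, this costs the code with
  \<open>b = 0\<close> exactly one dimension.\<close>

lemma q_cosets_0: "q_cosets q n {0..D} = insert 0 (q_cosets q n {1..D})"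
proof -
  have split: "{0..D} = {0} \<union> {1..D}" by auto
  have "q_cosets q n {0} = {0}" unfolding q_cosets_def by auto
  moreover have "q_cosets q n (A \<union> B) = q_cosets q n A \<union> q_cosets q n B" for A B
    unfolding q_cosets_def by blast
  ultimately show ?thesis unfolding split by (metis insert_is_Un)
qed

lemma zero_notin_q_cosets:
  assumes D: "int (lam * D) \<le> bnd"
  shows "0 \<notin> q_cosets q n {1..D}"
proof
  assume "0 \<in> q_cosets q n {1..D}"
  then obtain i s where i: "i \<in> {1..D}" "0 = (i * q ^ s) mod n" unfolding q_cosets_def by blast
  then have "n dvd i * q ^ s" by (simp only: dvd_eq_mod_eq_0)
  then have "n dvd i" using coprime_q_n by (simp add: coprime_commute coprime_dvd_mult_left_iff)
  then have "n \<le> i" using i by (auto intro: dvd_imp_le)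
  then have "lam * n \<le> lam * D" using i by (intro mult_le_mono2) auto
  then have "int (lam * n) \<le> int (lam * D)" by (simp only: of_nat_le_iff)
  then show False using D bnd_less(1) modulus_n by simp
qed

end

section \<open>Counting the coset leaders\<close>

lemma mult_le_iff_le_div: "0 < c \<Longrightarrow> c * w \<le> b \<longleftrightarrow> w \<le> b div c" for b c w :: int
proof
  assume c: "0 < c" and "c * w \<le> b"
  then have "(c * w) div c \<le> b div c" by (intro zdiv_mono1)
  then show "w \<le> b div c" using c by simp
next
  assume c: "0 < c" and "w \<le> b div c"
  then have "c * w \<le> c * (b div c)" by simp
  also have "\<dots> = b - b mod c" by (simp add: minus_mod_eq_mult_div)
  also have "\<dots> \<le> b" using c by simp
  finally show "c * w \<le> b" .
qed

lemma card_not_dvd_atMost: "card {i \<in> {1..D}. \<not> q dvd i} = D - D div q" if "0 < q" for D q :: nat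
proof (induction D)
  case (Suc D)
  have "{i \<in> {1..Suc D}. \<not> q dvd i}
      = {i \<in> {1..D}. \<not> q dvd i} \<union> (if q dvd Suc D then {} else {Suc D})"
    by (auto simp: le_Suc_eq)
  moreover have "D div q \<le> D" by simp
  ultimately show ?case
    using Suc that by (auto simp: div_Suc dvd_eq_mod_eq_0 Suc_diff_le simp del: mod_eq_0_iff_dvd mod_0_imp_dvd)
qed simp

text \<open>Identifies \<epsilon> and \<tau> as counts of the numbers up to a bound that
  \<open>q\<close> does not divide.\<close>

lemma ceiling_mult_one_minus_inverse:
  "\<lceil>real D * (1 - 1 / real q)\<rceil> = int D - int (D div q)" if "0 < q"
proof -
  have "real D * (1 - 1 / real q) = - (real D / real q - of_int (int D))"
    by (simp add: algebra_simps)
  also have "\<lceil>\<dots>\<rceil> = - \<lfloor>real D / real q - of_int (int D)\<rfloor>" by (simp only: ceiling_def minus_minus)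
  also have "\<dots> = int D - \<lfloor>real D / real q\<rfloor>" by (simp only: floor_diff_of_int)
  also have "\<lfloor>real D / real q\<rfloor> = int (D div q)" by (rule floor_divide_of_nat_eq)
  finally show ?thesis .
qed

context bch_params
begin

text \<open>The constants \<open>A, B, L, M, Q, \<kappa>\<close> of the theorem; \<open>{lo..hi}\<close> is the window of non-leaders
  around \<open>A\<close>.\<close>

definition cA :: int where "cA = int ((q ^ (t + 1) + 1) div lam)"
definition cB :: int where "cB = int ((2 * (q ^ t - 1)) div lam)"
definition cL :: int where "cL = int ((q - 3) div lam)"
definition cM :: int where "cM = int ((q - 1) div lam)"
definition cQ :: int where "cQ = int (q ^ t)"
definition lo :: int where "lo = cA - int (q div lam)"
definition hi :: int where "hi = cA + int ((q - 2) div lam)"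
definition kap :: int where "kap = 2 * cA - int ((2 * q + 1) div lam)"

abbreviation l :: int where "l \<equiv> int lam"

lemma l2: "2 \<le> l" "0 < l" "l \<le> int q" using lam2 lam_less by auto

lemma cQ_eq: "int q ^ t = cQ" by (simp add: cQ_def)

lemma cQ_ge: "3 * int q \<le> cQ" using P3 by (simp add: cQ_eq)

text \<open>Evenness of \<open>t\<close> enters here: \<open>q\<close> is -1 modulo
  \<open>lam\<close>, so \<open>q ^ t\<close> is 1.\<close>

lemma l_dvd_cQ: "l dvd cQ - 1"
proof -
  have "int lam dvd int (q + 1)" using lam_dvd by (simp only: int_dvd_int_iff)
  then have "[int q = -1] (mod l)" by (simp add: cong_iff_dvd_diff add.commute)
  then have "[int q ^ t = (-1) ^ t] (mod l)" by (rule cong_pow)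
  then show ?thesis using even_t by (simp add: cong_iff_dvd_diff cQ_eq)
qed

text \<open>The division defining \<open>cA\<close> is exact, as \<open>q ^ (t + 1) + 1\<close> is
  congruent to \<open>q + 1\<close> modulo \<open>lam\<close>.\<close>

lemma l_cA: "l * cA = int q * cQ + 1"
proof -
  have "l dvd int q * (cQ - 1) + int (q + 1)"
    using l_dvd_cQ lam_dvd by (intro dvd_add dvd_mult) (simp_all only: int_dvd_int_iff)
  then have "l dvd int (q ^ (t + 1) + 1)" by (simp add: cQ_def algebra_simps)
  then have "int (lam * ((q ^ (t + 1) + 1) div lam)) = int (q ^ (t + 1) + 1)"
    by (simp only: int_dvd_int_iff dvd_mult_div_cancel)
  then show ?thesis by (simp add: cA_def cQ_def)
qed

lemma l_cB: "l * cB = 2 * cQ - 2"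
proof -
  have 1: "1 \<le> q ^ t" using q3 by simp
  have "l dvd 2 * (cQ - 1)" using l_dvd_cQ by (rule dvd_mult)
  then have "l dvd int (2 * (q ^ t - 1))" using 1 by (simp add: cQ_def of_nat_diff)
  then have "int (lam * ((2 * (q ^ t - 1)) div lam)) = int (2 * (q ^ t - 1))"
    by (simp only: int_dvd_int_iff dvd_mult_div_cancel)
  then show ?thesis using 1 by (simp add: cB_def cQ_def of_nat_diff)
qed

lemma le_div_iff_mult_le:
  "l * w \<le> int q \<longleftrightarrow> w \<le> int (q div lam)"
  "l * w \<le> int q - 2 \<longleftrightarrow> w \<le> int ((q - 2) div lam)"
  "l * w \<le> int q - 3 \<longleftrightarrow> w \<le> cL"
  "l * w \<le> int q - 1 \<longleftrightarrow> w \<le> cM"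
  "l * w \<le> 2 * int q + 1 \<longleftrightarrow> w \<le> int ((2 * q + 1) div lam)"
proof -
  have "int (q div lam) = int q div l" "int ((q - 2) div lam) = (int q - 2) div l"
    "cL = (int q - 3) div l" "cM = (int q - 1) div l" "int ((2 * q + 1) div lam) = (2 * int q + 1) div l"
    using q3 by (simp_all add: cL_def cM_def zdiv_int of_nat_diff add.commute)
  then show "l * w \<le> int q \<longleftrightarrow> w \<le> int (q div lam)"
    "l * w \<le> int q - 2 \<longleftrightarrow> w \<le> int ((q - 2) div lam)"
    "l * w \<le> int q - 3 \<longleftrightarrow> w \<le> cL" "l * w \<le> int q - 1 \<longleftrightarrow> w \<le> cM"
    "l * w \<le> 2 * int q + 1 \<longleftrightarrow> w \<le> int ((2 * q + 1) div lam)"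
    using mult_le_iff_le_div[OF l2(2)] by (simp_all only:)
qed

lemma l_dvd_mult_cQ: "l dvd u * cQ \<longleftrightarrow> l dvd u"
proof -
  have "coprime l (int q)" using coprime_q_lam by (simp add: coprime_commute)
  then have "coprime l cQ" by (simp add: cQ_eq[symmetric])
  then show ?thesis by (simp add: coprime_dvd_mult_left_iff)
qed

text \<open>Here \<open>l * (z - cA) = u - 1\<close>; this offset by 1 is why the two ends involve
  \<open>q\<close> and \<open>q - 2\<close>.\<close>

lemma window_iff: "(\<exists>u. \<bar>u\<bar> < int q \<and> l * z = int q * cQ + u) \<longleftrightarrow> lo \<le> z \<and> z \<le> hi"
proof -
  have "(\<exists>u. \<bar>u\<bar> < int q \<and> l * z = int q * cQ + u) \<longleftrightarrow> \<bar>l * z - int q * cQ\<bar> < int q"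
    by (auto intro: exI[of _ "l * z - int q * cQ"])
  also have "\<dots> \<longleftrightarrow> l * (cA - z) \<le> int q \<and> l * (z - cA) \<le> int q - 2"
    using l_cA by (simp only: right_diff_distrib) linarith
  also have "\<dots> \<longleftrightarrow> lo \<le> z \<and> z \<le> hi"
    unfolding le_div_iff_mult_le lo_def hi_def by auto
  finally show ?thesis .
qed

lemma top_iff: "2 * (int q * cQ) - 2 * int q < l * z \<longleftrightarrow> kap \<le> z"
proof -
  have "l * (2 * cA - z) = 2 * (l * cA) - l * z" by (simp add: right_diff_distrib)
  also have "\<dots> = 2 * (int q * cQ) + 2 - l * z" by (simp add: l_cA)
  finally have "2 * (int q * cQ) - 2 * int q < l * z \<longleftrightarrow> l * (2 * cA - z) \<le> 2 * int q + 1"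
    by (simp only:) auto
  also have "\<dots> \<longleftrightarrow> kap \<le> z" unfolding le_div_iff_mult_le kap_def by auto
  finally show ?thesis .
qed

text \<open>Here \<open>l * (z - cA) = u * cQ\<close>, and \<open>l\<close> is prime to
  \<open>cQ\<close>, so \<open>u\<close> is a multiple \<open>l * a\<close>.\<close>

lemma upper_iff:
  "(\<exists>u. 1 \<le> u \<and> u < int q \<and> l * z = int q * cQ + u * cQ + 1) \<longleftrightarrow> (\<exists>a\<in>{1..cM}. z = cA + a * cQ)"
proof
  assume "\<exists>u. 1 \<le> u \<and> u < int q \<and> l * z = int q * cQ + u * cQ + 1"
  then obtain u where u: "1 \<le> u" "u < int q" "l * z = int q * cQ + u * cQ + 1" by blast
  then have e: "l * (z - cA) = u * cQ" using l_cA by (simp add: right_diff_distrib)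
  then have "l dvd u * cQ" by (metis dvd_triv_left)
  then obtain a where a: "u = l * a" unfolding l_dvd_mult_cQ by (auto simp: dvd_def)
  have "l * (z - cA) = l * (a * cQ)" using e a by (simp add: mult.assoc)
  then have "z = cA + a * cQ" using l2 by simp
  moreover have "a \<le> cM" using u(2) a le_div_iff_mult_le(4)[of a] by simp
  moreover have "1 \<le> a" using u(1) a l2 by (metis int_one_le_iff_zero_less zero_less_mult_pos)
  ultimately show "\<exists>a\<in>{1..cM}. z = cA + a * cQ" by auto
next
  assume "\<exists>a\<in>{1..cM}. z = cA + a * cQ"
  then obtain a where a: "1 \<le> a" "a \<le> cM" "z = cA + a * cQ" by auto
  have "l * a \<le> int q - 1" using a le_div_iff_mult_le(4)[of a] by simp
  moreover have "1 * 1 \<le> l * a" using a l2 by (intro mult_mono) auto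
  moreover have "l * z = int q * cQ + (l * a) * cQ + 1" using l_cA a by (simp add: algebra_simps)
  ultimately show "\<exists>u. 1 \<le> u \<and> u < int q \<and> l * z = int q * cQ + u * cQ + 1"
    by (intro exI[of _ "l * a"]) auto
qed

text \<open>As \<open>l * (cA + cB) = (int q + 2) * cQ - 1\<close>, the multiple of \<open>l\<close>
  is now \<open>u - 2\<close>; this turns the bound \<open>u < q\<close> into
  \<open>a \<le> cL\<close>.\<close>

lemma lower_iff:
  "(\<exists>u. 1 \<le> u \<and> u < int q \<and> l * z = int q * cQ + u * cQ - 1) \<longleftrightarrow> (\<exists>a\<in>{0..cL}. z = cA + cB + a * cQ)"
proof
  assume "\<exists>u. 1 \<le> u \<and> u < int q \<and> l * z = int q * cQ + u * cQ - 1"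
  then obtain u where u: "1 \<le> u" "u < int q" "l * z = int q * cQ + u * cQ - 1" by blast
  have e: "l * (z - cA - cB) = (u - 2) * cQ"
    using l_cA l_cB u by (simp add: right_diff_distrib left_diff_distrib)
  then have "l dvd (u - 2) * cQ" by (metis dvd_triv_left)
  then obtain a where a: "u - 2 = l * a" unfolding l_dvd_mult_cQ by (auto simp: dvd_def)
  have "l * (z - cA - cB) = l * (a * cQ)" using e a by (simp add: mult.assoc)
  then have "z = cA + cB + a * cQ" using l2 by simp
  moreover have "a \<le> cL" using u(2) a le_div_iff_mult_le(3)[of a] by simp
  \<comment> \<open>From \<open>1 \<le> u\<close> only \<open>-1 \<le> l * a\<close> follows;
    \<open>2 \<le> l\<close> then excludes negative \<open>a\<close>.\<close>
  moreover have "0 \<le> a"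
  proof (rule ccontr)
    assume "\<not> 0 \<le> a"
    then have "l * a \<le> l * (-1)" using l2 by (intro mult_left_mono) auto
    then show False using u(1) a l2 by linarith
  qed
  ultimately show "\<exists>a\<in>{0..cL}. z = cA + cB + a * cQ" by auto
next
  assume "\<exists>a\<in>{0..cL}. z = cA + cB + a * cQ"
  then obtain a where a: "0 \<le> a" "a \<le> cL" "z = cA + cB + a * cQ" by auto
  have "l * a \<le> int q - 3" using a le_div_iff_mult_le(3)[of a] by simp
  moreover have "0 \<le> l * a" using a by simp
  moreover have "l * z = int q * cQ + (l * a + 2) * cQ - 1"
    using l_cA l_cB a by (simp add: algebra_simps)
  ultimately show "\<exists>u. 1 \<le> u \<and> u < int q \<and> l * z = int q * cQ + u * cQ - 1"
    by (intro exI[of _ "l * a + 2"]) auto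
qed

text \<open>The tail from \<open>kap\<close> on is kept apart: it contains no leaders, so the count
  stops growing there.\<close>

definition dups :: "int set" where
  "dups = {lo..hi} \<union> (\<lambda>a. cA + cB + a * cQ) ` {0..cL} \<union> (\<lambda>a. cA + a * cQ) ` {1..cM}"

lemma dup_iff: "dup (l * z) \<longleftrightarrow> z \<in> dups \<or> kap \<le> z"
proof -
  have "dup (l * z) \<longleftrightarrow> (\<exists>u. \<bar>u\<bar> < int q \<and> l * z = int q * cQ + u)
      \<or> 2 * (int q * cQ) - 2 * int q < l * z
      \<or> (\<exists>u. 1 \<le> u \<and> u < int q \<and> l * z = int q * cQ + u * cQ + 1)
      \<or> (\<exists>u. 1 \<le> u \<and> u < int q \<and> l * z = int q * cQ + u * cQ - 1)"
    unfolding dup_def unfolding cQ_eq by blast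
  then show ?thesis
    unfolding window_iff top_iff upper_iff lower_iff dups_def by auto
qed

text \<open>Makes these exceptions disjoint from the multiples of \<open>q\<close>, so that the two
  are subtracted separately. In the window, a multiple of \<open>q\<close> would give
  \<open>l * (cA - int i) = 1\<close>; on the progressions \<open>l * int i\<close> is 1 or -1
  modulo \<open>q\<close>.\<close>

lemma dups_not_dvd:
  assumes "int i \<in> dups"
  shows "\<not> q dvd i"
proof
  assume "q dvd i"
  then have qd: "int q dvd l * int i" by (simp add: int_dvd_int_iff)
  have qQ: "int q dvd cQ" using t2 unfolding cQ_eq[symmetric] by (simp add: dvd_power)
  have "(\<exists>u. \<bar>u\<bar> < int q \<and> l * int i = int q * cQ + u)
      \<or> (\<exists>u. l * int i = int q * cQ + u * cQ + 1) \<or> (\<exists>u. l * int i = int q * cQ + u * cQ - 1)"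
    using assms window_iff[of "int i"] upper_iff[of "int i"] lower_iff[of "int i"]
    unfolding dups_def by auto
  then consider u where "\<bar>u\<bar> < int q" "l * int i = int q * cQ + u"
    | u where "l * int i = (int q + u) * cQ + 1" | u where "l * int i = (int q + u) * cQ - 1"
    by (auto simp: distrib_right)
  then show False
  proof cases
    case 1
    then have "int q dvd u" using qd by (metis dvd_add_right_iff dvd_triv_left)
    then have "u = 0" using 1(1) zdvd_not_zless[of "\<bar>u\<bar>" "int q"] by auto
    then have "l * (cA - int i) = 1" using l_cA 1 by (simp add: right_diff_distrib)
    then have "l dvd 1" by (metis dvd_triv_left)
    then show False using l2 by simp
  next
    case 2
    then have "int q dvd 1" using qd qQ by (metis dvd_add_right_iff dvd_mult)
    then show False using q3 by simp
  next
    case 3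
    then have "int q dvd (int q + u) * cQ - 1" using qd by simp
    moreover have "int q dvd (int q + u) * cQ" using qQ by simp
    ultimately have "int q dvd 1" using dvd_diff_right_iff by blast
    then show False using q3 by simp
  qed
qed

text \<open>These fix the order of the breakpoints. Most are compared after multiplication by
  \<open>l\<close>, where \<open>cA\<close> and \<open>cB\<close> become expressions in
  \<open>q\<close> and \<open>cQ\<close> without division.\<close>

lemma const_bounds:
  shows lo_pos: "1 \<le> lo" and lo_hi: "lo \<le> hi" and hi_less: "hi < cA + cB"
    and cB_less: "0 < cB" "cB < cQ" and cL_nonneg: "0 \<le> cL" and cL_cM: "cL \<le> cM"
    and cL_kap: "cA + cB + cL * cQ < kap" and cM_kap: "cA + cM * cQ < kap"
proof -
  have canc: "x < y" if "l * x < l * y" for x y using that l2 by simp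
  have Q: "3 * int q \<le> cQ" "3 \<le> int q" using cQ_ge q3 by auto
  have qQ: "3 * cQ \<le> int q * cQ" using Q by (intro mult_right_mono) auto
  have d: "l * int (q div lam) \<le> int q" "l * int ((q - 2) div lam) \<le> int q - 2"
    "l * cL \<le> int q - 3" "l * cM \<le> int q - 1" "l * int ((2 * q + 1) div lam) \<le> 2 * int q + 1"
    unfolding le_div_iff_mult_le by simp_all
  have llo: "l * lo = int q * cQ + 1 - l * int (q div lam)"
    by (simp add: lo_def right_diff_distrib l_cA)
  have lhi: "l * hi = int q * cQ + 1 + l * int ((q - 2) div lam)"
    by (simp add: hi_def distrib_left l_cA)
  have lkap: "2 * (int q * cQ) + 1 - 2 * int q \<le> l * kap"
  proof -
    have "l * kap = 2 * (l * cA) - l * int ((2 * q + 1) div lam)"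
      by (simp add: kap_def algebra_simps)
    also have "\<dots> = 2 * (int q * cQ) + 2 - l * int ((2 * q + 1) div lam)" by (simp add: l_cA)
    finally show ?thesis using d(5) by linarith
  qed
  have "l * 0 < l * lo" using llo d(1) qQ Q by linarith
  then show "1 \<le> lo" using canc[of 0 lo] by simp
  show "lo \<le> hi" unfolding lo_def hi_def by linarith
  have "l * hi < l * (cA + cB)" unfolding lhi distrib_left l_cA l_cB using d(2) Q by linarith
  then show "hi < cA + cB" by (rule canc)
  have "l * 0 < l * cB" unfolding l_cB using Q by simp
  then show "0 < cB" by (rule canc)
  have "2 * cQ \<le> l * cQ" using l2 Q by (intro mult_right_mono) auto
  then have "l * cB < l * cQ" unfolding l_cB by linarith
  then show "cB < cQ" by (rule canc)
  show "0 \<le> cL" by (simp add: cL_def)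
  show "cL \<le> cM" unfolding cL_def cM_def by (simp add: div_le_mono)
  have "l * cL * cQ \<le> (int q - 3) * cQ" using d(3) Q by (intro mult_right_mono) auto
  moreover have "(int q - 3) * cQ = int q * cQ - 3 * cQ" by (simp add: algebra_simps)
  moreover have "l * (cA + cB + cL * cQ) = l * cA + l * cB + l * cL * cQ" by (simp add: algebra_simps)
  ultimately have "l * (cA + cB + cL * cQ) < l * kap" using lkap Q unfolding l_cA l_cB by linarith
  then show "cA + cB + cL * cQ < kap" by (rule canc)
  have "l * cM * cQ \<le> (int q - 1) * cQ" using d(4) Q by (intro mult_right_mono) auto
  moreover have "(int q - 1) * cQ = int q * cQ - cQ" by (simp add: algebra_simps)
  moreover have "l * (cA + cM * cQ) = l * cA + l * cM * cQ" by (simp add: algebra_simps)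
  ultimately have "l * (cA + cM * cQ) < l * kap" using lkap Q unfolding l_cA by linarith
  then show "cA + cM * cQ < kap" by (rule canc)
qed

section \<open>Counting leaders below and above \<open>kap\<close>\<close>

definition leaders :: "nat \<Rightarrow> nat set" where "leaders D = {i \<in> {1..D}. leader i}"

lemma leader_iff':
  assumes "1 \<le> i" "int (lam * i) \<le> bnd"
  shows "leader i \<longleftrightarrow> \<not> q dvd i \<and> int i \<notin> dups \<and> int i < kap"
  using leader_iff[OF assms] dup_iff[of "int i"] by auto

lemma bnd_mono: "int (lam * D) \<le> bnd \<Longrightarrow> i \<le> D \<Longrightarrow> int (lam * i) \<le> bnd"
proof -
  assume D: "int (lam * D) \<le> bnd" and "i \<le> D"
  then have "lam * i \<le> lam * D" by simp
  then have "int (lam * i) \<le> int (lam * D)" by (simp only: of_nat_le_iff)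
  then show ?thesis using D by simp
qed

lemma kap_pos: "1 \<le> kap"
proof -
  have "0 \<le> cL * cQ" using cL_nonneg cB_less by simp
  then show ?thesis using cL_kap lo_pos lo_hi hi_less by linarith
qed

text \<open>The reason why \<tau> replaces \<epsilon> in the last ranges.\<close>

lemma leaders_above_kap:
  assumes D: "int (lam * D) \<le> bnd" "kap \<le> int D"
  shows "leaders D = leaders (nat (kap - 1))"
proof -
  have le: "nat (kap - 1) \<le> D" using D by simp
  show ?thesis
    unfolding leaders_def using leader_iff' bnd_mono[OF D(1)] le kap_pos D(2) by auto
qed

lemma card_leaders_below_kap:
  assumes D: "int (lam * D) \<le> bnd" "int D < kap"
  shows "int (card (leaders D)) = int D - int (D div q) - int (card (dups \<inter> {1..int D}))"
proof -
  let ?N = "{i \<in> {1..D}. \<not> q dvd i}" and ?E = "{i \<in> {1..D}. int i \<in> dups}"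
  have "leaders D = ?N - ?E"
    unfolding leaders_def using leader_iff' bnd_mono[OF D(1)] D(2) by auto
  moreover have EN: "?E \<subseteq> ?N" using dups_not_dvd by auto
  moreover have "card ?E \<le> card ?N" using EN by (intro card_mono) auto
  ultimately have "int (card (leaders D)) = int (card ?N) - int (card ?E)"
    by (simp add: card_Diff_subset of_nat_diff)
  moreover have "int (card ?N) = int D - int (D div q)"
    using card_not_dvd_atMost[of q D] q3 by (simp add: of_nat_diff)
  moreover have "int ` ?E = dups \<inter> {1..int D}"
  proof (intro equalityI subsetI)
    fix z assume z: "z \<in> dups \<inter> {1..int D}"
    then have "z = int (nat z)" "nat z \<in> ?E" by auto
    then show "z \<in> int ` ?E" by (rule image_eqI)
  qed auto
  then have "card ?E = card (dups \<inter> {1..int D})"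
    using card_image[of int ?E] by simp
  ultimately show ?thesis by simp
qed

lemma card_dups_below:
  assumes "D < lo"
  shows "card (dups \<inter> {1..D}) = 0"
proof -
  have "D < z" if z: "z \<in> dups" for z
  proof -
    have lo: "lo \<le> cA" by (simp add: lo_def)
    have pos: "0 \<le> a * cQ" if "0 \<le> a" for a using that cB_less by simp
    consider "lo \<le> z" | a where "0 \<le> a" "z = cA + cB + a * cQ" | a where "1 \<le> a" "z = cA + a * cQ"
      using z unfolding dups_def by auto
    then show ?thesis
    proof cases
      case 1
      then show ?thesis using assms by simp
    next
      case (2 a)
      then show ?thesis using pos[of a] lo assms cB_less by linarith
    next
      case (3 a)
      then show ?thesis using pos[of a] lo assms cB_less by linarith
    qed
  qed
  then have "dups \<inter> {1..D} = {}" by fastforce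
  then show ?thesis by simp
qed

lemma card_dups_window:
  assumes "lo \<le> D" "D < hi"
  shows "int (card (dups \<inter> {1..D})) = D - lo + 1"
proof -
  have "D < cA + cB + a * cQ" if "0 \<le> a" for a
    using that hi_less assms cB_less mult_nonneg_nonneg[of a cQ] by linarith
  moreover have "D < cA + a * cQ" if "1 \<le> a" for a
    using hi_less assms cB_less mult_right_mono[OF that, of cQ] by linarith
  ultimately have "dups \<inter> {1..D} = {lo..D}"
    using assms lo_pos unfolding dups_def by fastforce
  then show ?thesis using assms by simp
qed

text \<open>\<open>x\<close> and \<open>y\<close> count the terms up to \<open>D\<close> of the
  progressions from \<open>cA + cB\<close> and from \<open>cA + cQ\<close>; the disjunctions cover a
  progression not yet begun or already exhausted. The progressions are disjoint because
  \<open>0 < cB < cQ\<close>.\<close>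

lemma card_dups_above:
  assumes D: "hi \<le> D" and x: "0 \<le> x" "x \<le> cL + 1" "x = 0 \<or> cA + cB + (x - 1) * cQ \<le> D"
      "x = cL + 1 \<or> D < cA + cB + x * cQ"
    and y: "0 \<le> y" "y \<le> cM" "y = 0 \<or> cA + y * cQ \<le> D" "y = cM \<or> D < cA + (y + 1) * cQ"
  shows "int (card (dups \<inter> {1..D})) = hi - lo + 1 + x + y"
proof -
  let ?f = "\<lambda>a. cA + cB + a * cQ" and ?g = "\<lambda>a. cA + a * cQ"
  have Q: "0 < cQ" using cB_less by simp
  have mono: "a * cQ \<le> b * cQ" if "a \<le> b" for a b using that Q by simp
  have A: "?f a \<le> D \<longleftrightarrow> a < x" if "0 \<le> a" "a \<le> cL" for a
    using x mono[of a "x - 1"] mono[of x a] that by (cases "a < x") auto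
  have B: "?g a \<le> D \<longleftrightarrow> a \<le> y" if "1 \<le> a" "a \<le> cM" for a
    using y mono[of a y] mono[of "y + 1" a] that by (cases "a \<le> y") auto
  have posf: "hi < ?f a" if "0 \<le> a" for a using mono[OF that] hi_less by linarith
  have posg: "hi < ?g a" if "1 \<le> a" for a using mono[OF that] hi_less cB_less by linarith
  have f_ran: "?f ` {0..cL} \<inter> {1..D} = ?f ` {0..<x}"
    using A x(2) posf lo_pos lo_hi by fastforce
  have g_ran: "?g ` {1..cM} \<inter> {1..D} = ?g ` {1..y}"
    using B y(2) posg lo_pos lo_hi by fastforce
  have "{lo..hi} \<inter> {1..D} = {lo..hi}" using lo_pos D by auto
  then have eq: "dups \<inter> {1..D} = {lo..hi} \<union> (?f ` {0..<x} \<union> ?g ` {1..y})"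
    unfolding dups_def Int_Un_distrib2 f_ran g_ran by (simp only: Un_assoc)
  have "?f a \<noteq> ?g b" for a b
  proof
    assume "?f a = ?g b"
    then have "cB = (b - a) * cQ" by (simp add: algebra_simps)
    then have "0 * cQ < (b - a) * cQ" "(b - a) * cQ < 1 * cQ" using cB_less by simp_all
    then have "0 < b - a" "b - a < 1" using Q by (simp_all only: mult_less_cancel_right_pos)
    then show False by simp
  qed
  then have disj: "?f ` {0..<x} \<inter> ?g ` {1..y} = {}" by blast
  have disj': "{lo..hi} \<inter> (?f ` {0..<x} \<union> ?g ` {1..y}) = {}"
    using posf posg by fastforce
  have "card (?f ` {0..<x}) = nat x" using Q by (subst card_image) (auto simp: inj_on_def)
  moreover have "card (?g ` {1..y}) = nat y" using Q by (subst card_image) (auto simp: inj_on_def)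
  ultimately have "card (dups \<inter> {1..D}) = nat (hi - lo + 1) + (nat x + nat y)"
    unfolding eq by (subst card_Un_disjoint) (use disj disj' in \<open>auto simp: card_Un_disjoint\<close>)
  then show ?thesis using x(1) y(1) lo_hi by simp
qed

end

section \<open>Code parameters on each range of the designed distance\<close>

theorem theorem3:
  fixes e :: "'a::{field,finite} \<Rightarrow> 'b::field" and \<beta> :: 'b
    and q lam m t n \<delta> :: nat
  assumes "card (UNIV :: 'a set) = q" and "\<exists>p r. prime p \<and> 0 < r \<and> q = p ^ r" and "odd q"
    and "lam dvd q + 1" and "2 \<le> lam" and "lam < q + 1"
    and "m = 2 * t + 1" and "m \<ge> 5" and "even t"
    and "n = (q ^ m + 1) div lam"
    and "is_field_emb e" and "\<beta> ^ n = 1" and "\<forall>j. 0 < j \<and> j < n \<longrightarrow> \<beta> ^ j \<noteq> 1"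
    and "1 \<le> int \<delta> - 1"
    and "real \<delta> - 1 \<le> (2 * real q ^ (t + 1) + 2 * real q - 1) / real lam"
  shows
   "let C1 = bch_code e \<beta> n \<delta> 1;
        C2 = bch_code e \<beta> n (\<delta> + 1) 0;
        P = (\<lambda>k. LCD_params n C1 k \<delta> \<and> LCD_params n C2 (k - 1) (2 * \<delta>));
        N = int n; d = int \<delta>; mm = int m; Q = int (q ^ t);
        A = int ((q ^ (t + 1) + 1) div lam);
        B = int ((2 * (q ^ t - 1)) div lam);
        \<epsilon> = \<lceil>(real \<delta> - 1) * (1 - 1 / real q)\<rceil>;
        \<upsilon> = int ((q - 2) div lam) + int (q div lam);
        L = int ((q - 3) div lam);
        M = int ((q - 1) div lam);
        \<kappa> = 2 * A - int ((2 * q + 1) div lam);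
        \<tau> = \<lceil>(real_of_int \<kappa> - 1) * (1 - 1 / real q)\<rceil>;
        U = (2 * real q ^ (t + 1) + 2 * real q - 1) / real lam + 1
    in is_LCD n C1 \<and> min_dist_ge n C1 \<delta> \<and> is_LCD n C2 \<and> min_dist_ge n C2 (2 * \<delta>) \<and>
       \<comment> \<open>(1)\<close>
       (2 \<le> d \<and> d \<le> A - int (q div lam) \<longrightarrow> P (N - 2 * mm * \<epsilon>)) \<and>
       (A - int (q div lam) < d \<and> d \<le> A + int ((q - 2) div lam) \<longrightarrow>
          P (N - 2 * mm * \<epsilon> + 2 * mm * (d - A + int (q div lam)))) \<and>
       (A + int ((q - 2) div lam) < d \<and> d \<le> A + B \<longrightarrow> P (N - 2 * mm * (\<epsilon> - \<upsilon> - 1))) \<and>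
       \<comment> \<open>(2)\<close>
       (L \<noteq> 0 \<longrightarrow> (\<forall>a::nat. int a \<le> L - 1 \<longrightarrow>
          (A + B + int a * Q < d \<and> d \<le> A + (int a + 1) * Q \<longrightarrow>
             P (N - 2 * mm * (\<epsilon> - \<upsilon> - 2 * int a - 2))) \<and>
          (A + (int a + 1) * Q < d \<and> d \<le> A + B + (int a + 1) * Q \<longrightarrow>
             P (N - 2 * mm * (\<epsilon> - \<upsilon> - 2 * int a - 3))))) \<and>
       \<comment> \<open>(3)(i)\<close>
       (M = L \<longrightarrow>
          (A + B + L * Q < d \<and> d \<le> \<kappa> \<longrightarrow> P (N - 2 * mm * (\<epsilon> - \<upsilon> - 2 * M - 2))) \<and>
          (\<kappa> < d \<and> real_of_int d \<le> U \<longrightarrow> P (N - 2 * mm * (\<tau> - \<upsilon> - 2 * M - 2)))) \<and>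
       \<comment> \<open>(3)(ii)\<close>
       (M = L + 1 \<longrightarrow>
          (A + B + L * Q < d \<and> d \<le> A + M * Q \<longrightarrow> P (N - 2 * mm * (\<epsilon> - \<upsilon> - 2 * M))) \<and>
          (A + M * Q < d \<and> d \<le> \<kappa> \<longrightarrow> P (N - 2 * mm * (\<epsilon> - \<upsilon> - 2 * M - 1))) \<and>
          (\<kappa> < d \<and> real_of_int d \<le> U \<longrightarrow> P (N - 2 * mm * (\<tau> - \<upsilon> - 2 * M - 1))))"
proof -
  obtain p r where pr: "prime p" "0 < r" "q = p ^ r" using assms(2) by blast
  have "1 < q" unfolding pr(3) using pr(1,2) prime_gt_1_nat by (intro one_less_power) auto
  with assms(3) have q3: "3 \<le> q" by (cases "q = 2") auto
  have t2: "2 \<le> t" using assms(7,8) by simp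
  \<comment> \<open>As \<open>m\<close> is odd, \<open>q ^ m\<close> is -1 modulo
    \<open>lam\<close>, so the division defining \<open>n\<close> is exact.\<close>
  have "[int q = -1] (mod int lam)"
    using assms(4) int_dvd_int_iff[of lam "q + 1"] by (simp add: cong_iff_dvd_diff add.commute)
  then have "[int q ^ m = (-1) ^ m] (mod int lam)" by (rule cong_pow)
  then have "int lam dvd int (q ^ m + 1)" using assms(7) by (simp add: cong_iff_dvd_diff add.commute)
  then have n_lam: "n * lam = q ^ m + 1" unfolding assms(10) by (simp only: int_dvd_int_iff dvd_div_mult_self)
  interpret bch_params q lam m t n
    by unfold_locales (use q3 assms t2 n_lam in auto)
  interpret root_of_unity_ext e \<beta> q n
    by unfold_locales (use assms coprime_q_n n_pos in auto)
  have h: "n dvd q ^ m + 1" unfolding n_lam[symmetric] by simp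
  \<comment> \<open>The defining exponents are 1..D and 0..D. An upper bound on \<delta> therefore
    becomes a strict bound on \<open>D\<close>.\<close>
  define D where "D = \<delta> - 1"
  have \<delta>: "\<delta> = D + 1" "1 \<le> D" using assms(14) by (auto simp: D_def)
  have bD: "int (lam * D) \<le> bnd"
  proof -
    have "real D * real lam \<le> 2 * real q ^ (t + 1) + 2 * real q - 1"
      using assms(15) lam2 by (simp add: \<delta> field_simps)
    then have "real_of_int (int (lam * D)) \<le> real_of_int bnd"
      by (simp add: bnd_def mult.commute)
    then show ?thesis by (simp only: of_int_le_iff)
  qed
  let ?C1 = "bch_code e \<beta> n \<delta> 1" and ?C2 = "bch_code e \<beta> n (\<delta> + 1) 0"
  let ?\<epsilon> = "\<lceil>(real \<delta> - 1) * (1 - 1 / real q)\<rceil>"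
    and ?\<tau> = "\<lceil>(real_of_int kap - 1) * (1 - 1 / real q)\<rceil>"
    and ?\<upsilon> = "int ((q - 2) div lam) + int (q div lam)"
  have LCD: "is_LCD n ?C1" "is_LCD n ?C2" by (rule is_LCD_bch_code[OF h])+
  have dist: "min_dist_ge n ?C1 \<delta>" "min_dist_ge n ?C2 (2 * \<delta>)"
    using min_dist_bch_code_1 min_dist_bch_code_0[OF h, of \<delta>] \<delta> by simp_all
  \<comment> \<open>Both dimensions depend only on the number of leaders up to \<open>D\<close>,
    which is all that the remaining cases compute.\<close>
  have params: "LCD_params n ?C1 (int n - 2 * int m * K) \<delta> \<and>
      LCD_params n ?C2 (int n - 2 * int m * K - 1) (2 * \<delta>)" if "int (card (leaders D)) = K" for K
  proof -
    have c1: "int (card (cosets {1..D})) = 2 * int m * K"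
      using card_q_cosets[OF bD] that by (simp add: leaders_def)
    have "finite (cosets {1..D})" using cosets_subset finite_subset by blast
    then have c0: "int (card (cosets {0..D})) = 2 * int m * K + 1"
      using c1 zero_notin_q_cosets[OF bD] unfolding q_cosets_0 by simp
    have "{1..1 + \<delta> - 2} = {1..D}" "{0..0 + (\<delta> + 1) - 2} = {0..D}" using \<delta> by simp_all
    then show ?thesis
      unfolding LCD_params_def code_dim_bch_code using LCD dist c0 c1 by simp
  qed
  have eps: "?\<epsilon> = int D - int (D div q)"
    using ceiling_mult_one_minus_inverse[of q D] q3 by (simp add: \<delta>)
  have below: "int (card (leaders D)) = ?\<epsilon> - int (card (dups \<inter> {1..int D}))" if "int D < kap"
    using card_leaders_below_kap[OF bD that] eps by simp
  \<comment> \<open>\<tau> is the formula for \<epsilon> with \<open>D\<close> replaced by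
    \<open>kap - 1\<close>, the last index before the tail.\<close>
  have above: "int (card (leaders D)) = ?\<tau> - int (card (dups \<inter> {1..kap - 1}))" if k: "kap \<le> int D"
  proof -
    define E where "E = nat (kap - 1)"
    have E: "int E = kap - 1" using kap_pos by (simp add: E_def)
    have "real_of_int kap - 1 = real E" using E by (metis of_int_1 of_int_diff of_int_of_nat_eq)
    then have "?\<tau> = int E - int (E div q)"
      using ceiling_mult_one_minus_inverse[of q E] q3 by simp
    moreover have "int (lam * E) \<le> bnd" using bnd_mono[OF bD, of E] E k by simp
    ultimately show ?thesis
      using leaders_above_kap[OF bD k] card_leaders_below_kap[of E] E by (simp add: E_def)
  qed
  have \<upsilon>: "hi - lo = ?\<upsilon>" by (simp add: hi_def lo_def)
  have next_Q: "(a + 1) * cQ = a * cQ + cQ" for a by (simp add: algebra_simps)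
  have mono: "a * cQ \<le> b * cQ" if "a \<le> b" for a b using that cB_less by simp
  have d: "int \<delta> = int D + 1" by (simp add: \<delta>)
  have "0 \<le> cL * cQ" using cL_nonneg cB_less by simp
  note bounds = this lo_pos lo_hi hi_less cB_less cL_nonneg cL_cM cL_kap cM_kap
  have case1: "int (card (leaders D)) = ?\<epsilon>" if "int \<delta> \<le> lo"
  proof -
    have "int D < kap" "int D < lo" using that d bounds by linarith+
    then show ?thesis using below card_dups_below[of "int D"] by simp
  qed
  have case2: "int (card (leaders D)) = ?\<epsilon> - (int \<delta> - lo)" if "lo < int \<delta>" "int \<delta> \<le> hi"
  proof -
    have "int D < kap" "lo \<le> int D" "int D < hi" using that d bounds by linarith+
    then show ?thesis using below card_dups_window[of "int D"] d by simp
  qed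
  have case3: "int (card (leaders D)) = ?\<epsilon> - ?\<upsilon> - 1" if "hi < int \<delta>" "int \<delta> \<le> cA + cB"
  proof -
    have "int D < kap" "hi \<le> int D" "int D < cA + cB" "int D < cA + cQ"
      using that d bounds by linarith+
    then show ?thesis using below card_dups_above[of "int D" 0 0] bounds \<upsilon> by simp
  qed
  have case4: "int (card (leaders D)) = ?\<epsilon> - ?\<upsilon> - 2 * a - 2"
    if "0 \<le> a" "a \<le> cL - 1" "cA + cB + a * cQ < int \<delta>" "int \<delta> \<le> cA + (a + 1) * cQ" for a
  proof -
    have a: "0 \<le> a * cQ" "(a + 1) * cQ \<le> cL * cQ" using mono[of 0 a] mono[of "a + 1" cL] that by auto
    have D: "int D < kap" "hi \<le> int D" "cA + cB + a * cQ \<le> int D" "cA + a * cQ \<le> int D"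
      "int D < cA + (a + 1) * cQ" "int D < cA + cB + (a + 1) * cQ"
      using that d bounds a unfolding next_Q by linarith+
    \<comment> \<open>The progression from \<open>cA + cB\<close> starts at multiplier 0 and has
      contributed \<open>a + 1\<close> terms; the other starts at 1 and has contributed
      \<open>a\<close>.\<close>
    have "int (card (dups \<inter> {1..int D})) = hi - lo + 1 + (a + 1) + a"
      by (rule card_dups_above[OF D(2)]) (use D that bounds in simp_all)
    then show ?thesis using below D(1) \<upsilon> by simp
  qed
  have case5: "int (card (leaders D)) = ?\<epsilon> - ?\<upsilon> - 2 * a - 3"
    if "0 \<le> a" "a \<le> cL - 1" "cA + (a + 1) * cQ < int \<delta>" "int \<delta> \<le> cA + cB + (a + 1) * cQ" for a
  proof -
    have a: "0 \<le> a * cQ" "(a + 1) * cQ \<le> cL * cQ" using mono[of 0 a] mono[of "a + 1" cL] that by auto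
    have D: "int D < kap" "hi \<le> int D" "cA + cB + a * cQ \<le> int D" "cA + (a + 1) * cQ \<le> int D"
      "int D < cA + (a + 1 + 1) * cQ" "int D < cA + cB + (a + 1) * cQ"
      using that d bounds a unfolding next_Q by linarith+
    \<comment> \<open>Now \<open>cA + (a + 1) * cQ\<close> has been passed as well, so both
      progressions have contributed \<open>a + 1\<close> terms.\<close>
    have "int (card (dups \<inter> {1..int D})) = hi - lo + 1 + (a + 1) + (a + 1)"
      by (rule card_dups_above[OF D(2)]) (use D that bounds in simp_all)
    then show ?thesis using below D(1) \<upsilon> by simp
  qed
  \<comment> \<open>Beyond the last terms of both progressions the exceptions are complete: the
    window, \<open>cL + 1\<close> terms and \<open>cM\<close> terms.\<close>
  have full: "int (card (dups \<inter> {1..z})) = ?\<upsilon> + cL + cM + 2"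
    if "cA + cB + cL * cQ \<le> z" "cA + cM * cQ \<le> z" for z
  proof -
    have z: "hi \<le> z" using that bounds by linarith
    have "int (card (dups \<inter> {1..z})) = hi - lo + 1 + (cL + 1) + cM"
      by (rule card_dups_above[OF z]) (use that bounds in simp_all)
    then show ?thesis using \<upsilon> by simp
  qed
  have case6: "int (card (leaders D)) = ?\<epsilon> - ?\<upsilon> - 2 * cM - 2"
    if "cM = cL" "cA + cB + cL * cQ < int \<delta>" "int \<delta> \<le> kap"
  proof -
    have "int D < kap" "cA + cB + cL * cQ \<le> int D" "cA + cL * cQ \<le> int D"
      using that d bounds by linarith+
    then show ?thesis using below full[of "int D"] that(1) by simp
  qed
  have case7: "int (card (leaders D)) = ?\<tau> - ?\<upsilon> - 2 * cM - 2" if "cM = cL" "kap < int \<delta>"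
    using above full[of "kap - 1"] that d cL_kap cM_kap by simp
  have case8: "int (card (leaders D)) = ?\<epsilon> - ?\<upsilon> - 2 * cM"
    if "cM = cL + 1" "cA + cB + cL * cQ < int \<delta>" "int \<delta> \<le> cA + cM * cQ"
  proof -
    have D: "int D < kap" "hi \<le> int D" "cA + cB + cL * cQ \<le> int D" "cA + cL * cQ \<le> int D"
      "int D < cA + (cL + 1) * cQ"
      using that(2,3) d bounds unfolding that(1) next_Q by linarith+
    \<comment> \<open>The progression from \<open>cA + cB\<close> is exhausted, while the other
      still lacks its last term, at multiplier \<open>cM = cL + 1\<close>.\<close>
    have "int (card (dups \<inter> {1..int D})) = hi - lo + 1 + (cL + 1) + cL"
      by (rule card_dups_above[OF D(2)]) (use D that(1) bounds in simp_all)
    then show ?thesis using below D(1) that(1) \<upsilon> by simp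
  qed
  have case9: "int (card (leaders D)) = ?\<epsilon> - ?\<upsilon> - 2 * cM - 1"
    if "cM = cL + 1" "cA + cM * cQ < int \<delta>" "int \<delta> \<le> kap"
  proof -
    have "int D < kap" "cA + cB + cL * cQ \<le> int D" "cA + (cL + 1) * cQ \<le> int D"
      using that(2,3) d bounds unfolding that(1) next_Q by linarith+
    then show ?thesis using below full[of "int D"] that(1) by simp
  qed
  have case10: "int (card (leaders D)) = ?\<tau> - ?\<upsilon> - 2 * cM - 1" if "cM = cL + 1" "kap < int \<delta>"
    using above full[of "kap - 1"] that d cL_kap cM_kap by simp
  have case2': "int n - 2 * int m * (x - (int \<delta> - lo))
      = int n - 2 * int m * x + 2 * int m * (int \<delta> - cA + int (q div lam))" for x
    by (simp add: lo_def algebra_simps)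
  show ?thesis
    unfolding Let_def cA_def[symmetric] cB_def[symmetric] cL_def[symmetric] cM_def[symmetric]
      cQ_def[symmetric] kap_def[symmetric] lo_def[symmetric] hi_def[symmetric]
    using LCD dist params[OF case1] params[OF case2, unfolded case2'] params[OF case3]
      params[OF case4] params[OF case5] params[OF case6] params[OF case7] params[OF case8]
      params[OF case9] params[OF case10]
    by (intro conjI impI allI) auto
qed

end
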